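(* Let $\mathcal X$ be a space of homogeneous type with degree $(\alpha_0,n_0,N_0)$, let $\varphi$ be a growth function on $\mathcal X\times[0,\infty)$, and let $\{A_t\}_{t>0}$ satisfy Assumption A. Suppose that, for every $t\in(0,\infty)$, the kernel $a_t$ of $A_t$ is a nonnegative function satisfying the lower bound $$a_t(x,y)\ge\frac{C}{\mu(B(x,t^{1/m}))}\qquad\text{for all } t\in(0,\infty),\ x\in\mathcal X,\ y\in B(x,t^{1/m}),$$ where $C$ is a positive constant independent of $t,x,y$. Then the spaces $\mathrm{BMO}^{\varphi}_{A,\max}(\mathcal X)$ and $\mathrm{BMO}^{\varphi}_A(\mathcal X)$ coincide with equivalent norms.
   Context: **Spaces of homogeneous type.** $(\mathcal X,d,\mu)$: $d:\mathcal X\times\mathcal X\to[0,\infty)$ is a quasi-metric ($d(x,y)=0$ iff $x=y$; $d(x,y)=d(y,x)$; $d(x,y)\le C_1[d(x,z)+d(z,y)]$ for a constant $C_1\in[1,\infty)$), and $\mu$ is a nonnegative Borel measure for which there is $C_2\in[1,\infty)$ with $\mu(B(x,2r))\le C_2\mu(B(x,r))<\infty$ for all balls $B(x,r)=\{y: d(y,x)<r\}$ (balls have positive measure). Consider the conditions: ($D_n$), $n\in(0,\infty)$: $\exists C$ with $\mu(B(x,\lambda r))\le C\lambda^n\mu(B(x,r))$ for all $x\in\mathcal X$, $r>0$, $\lambda\ge1$; ($E_N$), $N\in[0,\infty)$: $\exists C$ with $\mu(B(y,r))\le C[1+d(x,y)/r]^N\mu(B(x,r))$ for all $x,y\in\mathcal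 X$, $r>0$; ($R_\alpha$), $\alpha\in[0,n]$ with $n$ as in ($D_n$): $\exists C\ge1$ with $C^{-1}\lambda^\alpha\mu(B(x,r))\le\mu(B(x,\lambda r))$ for all $x\in\mathcal X$, $r\in(0,2\,\mathrm{diam}(\mathcal X))$, $\lambda\in[1,2\,\mathrm{diam}(\mathcal X)/r)$. Set $n_0=\inf\{n:(D_n)\}$, $N_0=\inf\{N:(E_N)\}$, $\alpha_0=\sup\{\alpha:(R_\alpha)\}$; $(\alpha_0,n_0,N_0)$ is the degree of $\mathcal X$. **Growth functions.** $\varphi:\mathcal X\times[0,\infty)\to[0,\infty)$ is of uniformly upper type $p$ (resp. uniformly lower type $p$) if $\exists C$ with $\varphi(x,st)\le Cs^p\varphi(x,t)$ for all $x\in\mathcal X$, $t\ge0$ and $s\ge1$ (resp. $s\in(0,1)$). For $p\in(1,\infty)$, $\varphi\in\mathbb A_p(\mathcal X)$ means $\sup_{t>0}\sup_{B}\frac1{\mu(B)}\int_B\varphi(x,t)\,d\mu(x)\{\frac1{\mu(B)}\int_B[\varphi(x,t)]^{-1/(p-1)}d\mu(x)\}^{p-1}<\infty$; $\varphi\in\mathbb A_1(\mathcal X)$ means $\sup_{t>0}\sup_B\frac1{\mu(B)}\int_B\varphi(x,t)d\mu(x)\,\{\mathrm{ess\,sup}_{y\in B}[\varphi(y,t)]^{-1}\}<\infty$; $\mathbb A_\infty=\bigcup_{p\in[1,\infty)}\mathbb A_p$. For $q\in(1,\infty)$, $\varphi\in\mathbb{RH}_q(\mathcal X)$ means $\sup_{t>0}\sup_B\{\frac1{\mu(B)}\int_B[\varphi(x,t)]^qd\mu(x)\}^{1/q}\{\frac1{\mu(B)}\int_B\varphi(x,t)d\mu(x)\}^{-1}<\infty$;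 for $q=\infty$ the first factor is replaced by $\mathrm{ess\,sup}_{y\in B}\varphi(y,t)$. (Suprema over all balls $B$.) $\varphi$ is a growth function if: for each $x$, $\varphi(x,\cdot)$ is an Orlicz function (nondecreasing, $\varphi(x,0)=0$, $\varphi(x,t)>0$ for $t>0$, $\lim_{t\to\infty}\varphi(x,t)=\infty$; not necessarily convex); $\varphi(\cdot,t)$ is measurable for each $t$; $\varphi\in\mathbb A_\infty(\mathcal X)$; and $\varphi$ is of uniformly upper type $1$ and of uniformly lower type $p$ for some $p\in(0,1]$. Indices: $i(\varphi)=\sup\{p\in(0,\infty):\varphi$ is of uniformly lower type $p\}$, $p(\varphi)=\inf\{p\in[1,\infty):\varphi\in\mathbb A_p(\mathcal X)\}$, $r(\varphi)=\sup\{q\in(1,\infty]:\varphi\in\mathbb{RH}_q(\mathcal X)\}$, with $(r-1)/r:=1$ if $r=\infty$. $\|f\|_{L^\varphi(\mathcal X)}=\inf\{\lambda>0:\int_{\mathcal X}\varphi(x,|f(x)|/\lambda)\,d\mu(x)\le1\}$; $\chi_B$ is the characteristic function of $B$. **Generalized approximation to the identity.** Fix $M>n_0[1+p(\varphi)/i(\varphi)]-\alpha_0$, a constant $m>0$, and a positive, bounded, decreasing function $g$ on $[0,\infty)$ with $\lim_{r\to\infty}r^Mg(r^m)=0$. The operators are $A_tf(x)=\int_{\mathcal X}a_t(x,y)f(y)\,d\mu(y)$, $t>0$, with $|a_t(x,y)|\le h_t(x,y):=\frac1{\mu(B(x,t^{1/m}))}g\big(\frac{[d(x,y)]^m}{t}\big)$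 for all $x,y\in\mathcal X$. They act on $f\in\mathcal M(\mathcal X):=\bigcup_{x_0\in\mathcal X}\bigcup_\beta\mathcal M_{(x_0,\beta)}(\mathcal X)$, the union over $0<\beta<M-n_0[1+p(\varphi)/i(\varphi)]+\alpha_0$, where $\mathcal M_{(x_0,\beta)}(\mathcal X)$ is the set of $f\in L^1_{\rm loc}(\mathcal X)$ with $\int_{\mathcal X}\frac{|f(x)|}{[1+d(x_0,x)]^{n_0p(\varphi)/i(\varphi)-\alpha_0+\beta}\,\mu(B(x_0,1+d(x_0,x)))}\,d\mu(x)<\infty$. **Assumption A.** $\{A_t\}_{t>0}$ is a generalized approximation to the identity, that is, $A_tf(x)=\int_{\mathcal X}a_t(x,y)f(y)\,d\mu(y)$ with $|a_t(x,y)|\le\frac1{\mu(B(x,t^{1/m}))}g\big(\frac{[d(x,y)]^m}{t}\big)$ for all $t>0$ and $x,y\in\mathcal X$, where $g$ is positive, bounded, decreasing and $\lim_{r\to\infty}r^Mg(r^m)=0$; $A_0:=I$ (identity), $A_tA_sf=A_{t+s}f$ almost everywhere for all $s,t\in[0,\infty)$ and $f\in\mathcal M(\mathcal X)$, and in addition $M>n_0+\frac{2n_0p(\varphi)}{i(\varphi)}+N_0-\frac{n_0[r(\varphi)-1]}{r(\varphi)}-\alpha_0.$ **Spaces.** $\mathrm{BMO}^\varphi_A(\mathcal X)$ is the set of $f\in\mathcal M(\mathcal X)$ with $\|f\|_{\mathrm{BMO}^\varphi_A(\mathcal X)}=\sup_B\frac1{\|\chi_B\|_{L^\varphi(\mathcal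 X)}}\int_B|f(x)-A_{t_B}f(x)|\,d\mu(x)<\infty$, the supremum over all balls $B$, with $t_B:=r_B^m$, $r_B$ the radius of $B$. $\mathrm{BMO}^\varphi_{A,\max}(\mathcal X)$ is the set of $f\in\mathcal M(\mathcal X)$ with $\|f\|_{\mathrm{BMO}^\varphi_{A,\max}(\mathcal X)}=\sup_{t\in(0,\infty),\,x\in\mathcal X}\frac{\mu(B(x,t^{1/m}))}{\|\chi_{B(x,t^{1/m})}\|_{L^\varphi(\mathcal X)}}\,|A_t(|f-A_tf|)(x)|<\infty.$ (These are seminorms.) *)

theory Defs
  imports "HOL-Probability.Essential_Supremum"
begin

section \<open>Spaces of homogeneous type\<close>

text \<open>The underlying set \<open>\<X>\<close> is \<^term>\<open>space \<mu>\<close>; quasi-metrics and functions on \<open>\<X>\<close> are total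
  HOL functions whose values off \<^term>\<open>space \<mu>\<close> are irrelevant.\<close>

definition qball :: "'a measure \<Rightarrow> ('a \<Rightarrow> 'a \<Rightarrow> real) \<Rightarrow> 'a \<Rightarrow> real \<Rightarrow> 'a set" where
  "qball \<mu> d x r = {y \<in> space \<mu>. d y x < r}"

definition qopen :: "'a measure \<Rightarrow> ('a \<Rightarrow> 'a \<Rightarrow> real) \<Rightarrow> 'a set \<Rightarrow> bool" where
  "qopen \<mu> d U \<longleftrightarrow> U \<subseteq> space \<mu> \<and> (\<forall>x\<in>U. \<exists>r>0. qball \<mu> d x r \<subseteq> U)"

definition quasi_metric :: "'a measure \<Rightarrow> ('a \<Rightarrow> 'a \<Rightarrow> real) \<Rightarrow> bool" where
  "quasi_metric \<mu> d \<longleftrightarrow>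
     (\<forall>x\<in>space \<mu>. \<forall>y\<in>space \<mu>. 0 \<le> d x y \<and> (d x y = 0 \<longleftrightarrow> x = y) \<and> d x y = d y x) \<and>
     (\<exists>C1\<ge>1. \<forall>x\<in>space \<mu>. \<forall>y\<in>space \<mu>. \<forall>z\<in>space \<mu>. d x y \<le> C1 * (d x z + d z y))"

text \<open>Balls of a quasi-metric need not be open, so their measurability is required separately
  from the measure being defined on the Borel sets.\<close>

definition homogeneous_type :: "'a measure \<Rightarrow> ('a \<Rightarrow> 'a \<Rightarrow> real) \<Rightarrow> bool" where
  "homogeneous_type \<mu> d \<longleftrightarrow>
     quasi_metric \<mu> d \<and>
     sets \<mu> = sigma_sets (space \<mu>) {U. qopen \<mu> d U} \<and>
     (\<forall>x\<in>space \<mu>. \<forall>r>0. qball \<mu> d x r \<in> sets \<mu> \<and>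
        0 < emeasure \<mu> (qball \<mu> d x r) \<and> emeasure \<mu> (qball \<mu> d x r) < \<infinity>) \<and>
     (\<exists>C2::real. C2 \<ge> 1 \<and> (\<forall>x\<in>space \<mu>. \<forall>r>0.
        emeasure \<mu> (qball \<mu> d x (2 * r)) \<le> ennreal C2 * emeasure \<mu> (qball \<mu> d x r)))"

definition cond_D :: "'a measure \<Rightarrow> ('a \<Rightarrow> 'a \<Rightarrow> real) \<Rightarrow> real \<Rightarrow> bool" where
  "cond_D \<mu> d n \<longleftrightarrow> (\<exists>C. \<forall>x\<in>space \<mu>. \<forall>r>0. \<forall>l\<ge>1.
     measure \<mu> (qball \<mu> d x (l * r)) \<le> C * l powr n * measure \<mu> (qball \<mu> d x r))"

definition cond_E :: "'a measure \<Rightarrow> ('a \<Rightarrow> 'a \<Rightarrow> real) \<Rightarrow> real \<Rightarrow> bool" where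
  "cond_E \<mu> d N \<longleftrightarrow> (\<exists>C. \<forall>x\<in>space \<mu>. \<forall>y\<in>space \<mu>. \<forall>r>0.
     measure \<mu> (qball \<mu> d y r) \<le> C * (1 + d x y / r) powr N * measure \<mu> (qball \<mu> d x r))"

definition qdiam :: "'a measure \<Rightarrow> ('a \<Rightarrow> 'a \<Rightarrow> real) \<Rightarrow> ereal" where
  "qdiam \<mu> d = (SUP (x, y) \<in> space \<mu> \<times> space \<mu>. ereal (d x y))"

definition cond_R :: "'a measure \<Rightarrow> ('a \<Rightarrow> 'a \<Rightarrow> real) \<Rightarrow> real \<Rightarrow> bool" where
  "cond_R \<mu> d \<alpha> \<longleftrightarrow> (\<exists>C\<ge>1. \<forall>x\<in>space \<mu>. \<forall>r>0. \<forall>l\<ge>1.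
     ereal r < 2 * qdiam \<mu> d \<longrightarrow> ereal l < 2 * qdiam \<mu> d / ereal r \<longrightarrow>
     inverse C * l powr \<alpha> * measure \<mu> (qball \<mu> d x r) \<le> measure \<mu> (qball \<mu> d x (l * r)))"

definition deg_n :: "'a measure \<Rightarrow> ('a \<Rightarrow> 'a \<Rightarrow> real) \<Rightarrow> real" where
  "deg_n \<mu> d = Inf {n. 0 < n \<and> cond_D \<mu> d n}"

definition deg_N :: "'a measure \<Rightarrow> ('a \<Rightarrow> 'a \<Rightarrow> real) \<Rightarrow> real" where
  "deg_N \<mu> d = Inf {N. 0 \<le> N \<and> cond_E \<mu> d N}"

text \<open>If \<open>\<X>\<close> has at least two points, then \<open>(R\<^sub>\<alpha>)\<close> and \<open>(D\<^sub>n)\<close> force \<open>\<alpha> \<le> n\<close>, so the bound by every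
  admissible \<open>n\<close> imposes nothing. On a one-point space \<open>(R\<^sub>\<alpha>)\<close> is vacuous, and this bound makes the
  supremum \<open>0\<close>.\<close>

definition deg_alpha :: "'a measure \<Rightarrow> ('a \<Rightarrow> 'a \<Rightarrow> real) \<Rightarrow> real" where
  "deg_alpha \<mu> d = Sup {\<alpha>. 0 \<le> \<alpha> \<and> (\<forall>n>0. cond_D \<mu> d n \<longrightarrow> \<alpha> \<le> n) \<and> cond_R \<mu> d \<alpha>}"


section \<open>Growth functions\<close>

definition upper_type :: "'a measure \<Rightarrow> real \<Rightarrow> ('a \<Rightarrow> real \<Rightarrow> real) \<Rightarrow> bool" where
  "upper_type \<mu> p \<phi> \<longleftrightarrow>
     (\<exists>C. \<forall>x\<in>space \<mu>. \<forall>t\<ge>0. \<forall>s\<ge>1. \<phi> x (s * t) \<le> C * s powr p * \<phi> x t)"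

definition lower_type :: "'a measure \<Rightarrow> real \<Rightarrow> ('a \<Rightarrow> real \<Rightarrow> real) \<Rightarrow> bool" where
  "lower_type \<mu> p \<phi> \<longleftrightarrow>
     (\<exists>C. \<forall>x\<in>space \<mu>. \<forall>t\<ge>0. \<forall>s\<in>{0<..<1}. \<phi> x (s * t) \<le> C * s powr p * \<phi> x t)"

text \<open>The averages below are extended nonnegative reals: a weight that fails to be integrable on some
  ball has an infinite average there. Only positive exponents are used in \<open>ennpowr\<close>.\<close>

definition ennpowr :: "ennreal \<Rightarrow> real \<Rightarrow> ennreal" where
  "ennpowr u p = (if u = \<infinity> then \<infinity> else ennreal (enn2real u powr p))"

definition avg :: "'a measure \<Rightarrow> 'a set \<Rightarrow> ('a \<Rightarrow> real) \<Rightarrow> ennreal" where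
  "avg \<mu> B w = (\<integral>\<^sup>+y\<in>B. ennreal (w y) \<partial>\<mu>) / emeasure \<mu> B"

definition ess_sup_on :: "'a measure \<Rightarrow> 'a set \<Rightarrow> ('a \<Rightarrow> real) \<Rightarrow> ennreal" where
  "ess_sup_on \<mu> B w = esssup (restrict_space \<mu> B) (\<lambda>y. ennreal (w y))"

definition balls :: "'a measure \<Rightarrow> ('a \<Rightarrow> 'a \<Rightarrow> real) \<Rightarrow> 'a set set" where
  "balls \<mu> d = {qball \<mu> d x r | x r. x \<in> space \<mu> \<and> 0 < r}"

definition Ap :: "'a measure \<Rightarrow> ('a \<Rightarrow> 'a \<Rightarrow> real) \<Rightarrow> real \<Rightarrow> ('a \<Rightarrow> real \<Rightarrow> real) \<Rightarrow> bool" where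
  "Ap \<mu> d p \<phi> \<longleftrightarrow>
     (SUP t \<in> {0<..}. SUP B \<in> balls \<mu> d. avg \<mu> B (\<lambda>x. \<phi> x t) *
        (if p = 1 then ess_sup_on \<mu> B (\<lambda>y. inverse (\<phi> y t))
         else ennpowr (avg \<mu> B (\<lambda>x. \<phi> x t powr (- 1 / (p - 1)))) (p - 1))) < \<infinity>"

definition A_infty :: "'a measure \<Rightarrow> ('a \<Rightarrow> 'a \<Rightarrow> real) \<Rightarrow> ('a \<Rightarrow> real \<Rightarrow> real) \<Rightarrow> bool" where
  "A_infty \<mu> d \<phi> \<longleftrightarrow> (\<exists>p\<ge>1. Ap \<mu> d p \<phi>)"

definition RH :: "'a measure \<Rightarrow> ('a \<Rightarrow> 'a \<Rightarrow> real) \<Rightarrow> ereal \<Rightarrow> ('a \<Rightarrow> real \<Rightarrow> real) \<Rightarrow> bool" where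
  "RH \<mu> d q \<phi> \<longleftrightarrow>
     (SUP t \<in> {0<..}. SUP B \<in> balls \<mu> d.
        (if q = \<infinity> then ess_sup_on \<mu> B (\<lambda>y. \<phi> y t)
         else ennpowr (avg \<mu> B (\<lambda>x. \<phi> x t powr real_of_ereal q)) (1 / real_of_ereal q)) *
        inverse (avg \<mu> B (\<lambda>x. \<phi> x t))) < \<infinity>"

definition growth_function ::
    "'a measure \<Rightarrow> ('a \<Rightarrow> 'a \<Rightarrow> real) \<Rightarrow> ('a \<Rightarrow> real \<Rightarrow> real) \<Rightarrow> bool" where
  "growth_function \<mu> d \<phi> \<longleftrightarrow>
     (\<forall>x\<in>space \<mu>. mono_on {0..} (\<phi> x) \<and> \<phi> x 0 = 0 \<and> (\<forall>t>0. 0 < \<phi> x t) \<and>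
        filterlim (\<phi> x) at_top at_top) \<and>
     (\<forall>t\<ge>0. (\<lambda>x. \<phi> x t) \<in> borel_measurable \<mu>) \<and>
     A_infty \<mu> d \<phi> \<and>
     upper_type \<mu> 1 \<phi> \<and>
     (\<exists>p\<in>{0<..1}. lower_type \<mu> p \<phi>)"

definition i_index :: "'a measure \<Rightarrow> ('a \<Rightarrow> real \<Rightarrow> real) \<Rightarrow> real" where
  "i_index \<mu> \<phi> = Sup {p. 0 < p \<and> lower_type \<mu> p \<phi>}"

definition p_index ::
    "'a measure \<Rightarrow> ('a \<Rightarrow> 'a \<Rightarrow> real) \<Rightarrow> ('a \<Rightarrow> real \<Rightarrow> real) \<Rightarrow> real" where
  "p_index \<mu> d \<phi> = Inf {p. 1 \<le> p \<and> Ap \<mu> d p \<phi>}"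

definition r_index ::
    "'a measure \<Rightarrow> ('a \<Rightarrow> 'a \<Rightarrow> real) \<Rightarrow> ('a \<Rightarrow> real \<Rightarrow> real) \<Rightarrow> ereal" where
  "r_index \<mu> d \<phi> = Sup {q. 1 < q \<and> RH \<mu> d q \<phi>}"

definition r_ratio :: "ereal \<Rightarrow> real" where
  "r_ratio r = (if r = \<infinity> then 1 else (real_of_ereal r - 1) / real_of_ereal r)"

definition Lphi_norm ::
    "'a measure \<Rightarrow> ('a \<Rightarrow> real \<Rightarrow> real) \<Rightarrow> ('a \<Rightarrow> real) \<Rightarrow> ennreal" where
  "Lphi_norm \<mu> \<phi> f =
     Inf {ennreal l | l. 0 < l \<and> (\<integral>\<^sup>+x. ennreal (\<phi> x (\<bar>f x\<bar> / l)) \<partial>\<mu>) \<le> 1}"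


section \<open>Generalized approximations to the identity\<close>

definition weight_exponent ::
    "'a measure \<Rightarrow> ('a \<Rightarrow> 'a \<Rightarrow> real) \<Rightarrow> ('a \<Rightarrow> real \<Rightarrow> real) \<Rightarrow> real" where
  "weight_exponent \<mu> d \<phi> = deg_n \<mu> d * p_index \<mu> d \<phi> / i_index \<mu> \<phi> - deg_alpha \<mu> d"

definition L1_loc :: "'a measure \<Rightarrow> ('a \<Rightarrow> 'a \<Rightarrow> real) \<Rightarrow> ('a \<Rightarrow> complex) set" where
  "L1_loc \<mu> d = {f \<in> borel_measurable \<mu>. \<forall>B\<in>balls \<mu> d. set_integrable \<mu> B f}"

definition MX_at ::
    "'a measure \<Rightarrow> ('a \<Rightarrow> 'a \<Rightarrow> real) \<Rightarrow> ('a \<Rightarrow> real \<Rightarrow> real) \<Rightarrow> 'a \<Rightarrow> real \<Rightarrow> ('a \<Rightarrow> complex) set" where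
  "MX_at \<mu> d \<phi> x0 \<beta> = {f \<in> L1_loc \<mu> d.
     (\<integral>\<^sup>+x. ennreal (cmod (f x) /
        ((1 + d x0 x) powr (weight_exponent \<mu> d \<phi> + \<beta>) *
         measure \<mu> (qball \<mu> d x0 (1 + d x0 x)))) \<partial>\<mu>) < \<infinity>}"

definition MX ::
    "'a measure \<Rightarrow> ('a \<Rightarrow> 'a \<Rightarrow> real) \<Rightarrow> ('a \<Rightarrow> real \<Rightarrow> real) \<Rightarrow> real \<Rightarrow> ('a \<Rightarrow> complex) set" where
  "MX \<mu> d \<phi> M = (\<Union>x0\<in>space \<mu>.
     \<Union>\<beta>\<in>{0<..<M - deg_n \<mu> d * (1 + p_index \<mu> d \<phi> / i_index \<mu> \<phi>) + deg_alpha \<mu> d}. MX_at \<mu> d \<phi> x0 \<beta>)"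

definition op_A ::
    "'a measure \<Rightarrow> (real \<Rightarrow> 'a \<Rightarrow> 'a \<Rightarrow> complex) \<Rightarrow> real \<Rightarrow> ('a \<Rightarrow> complex) \<Rightarrow> 'a \<Rightarrow> complex" where
  "op_A \<mu> a t f x = (if t = 0 then f x else (LINT y|\<mu>. a t x y * f y))"

text \<open>Joint measurability of the kernels is the tacit condition under which the integrals
  defining the operators, and those of their values, make sense.\<close>

definition gen_approx_identity ::
    "'a measure \<Rightarrow> ('a \<Rightarrow> 'a \<Rightarrow> real) \<Rightarrow> ('a \<Rightarrow> real \<Rightarrow> real) \<Rightarrow> real \<Rightarrow> real \<Rightarrow> (real \<Rightarrow> real) \<Rightarrow>
     (real \<Rightarrow> 'a \<Rightarrow> 'a \<Rightarrow> complex) \<Rightarrow> bool" where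
  "gen_approx_identity \<mu> d \<phi> M m g a \<longleftrightarrow>
     M > deg_n \<mu> d * (1 + p_index \<mu> d \<phi> / i_index \<mu> \<phi>) - deg_alpha \<mu> d \<and>
     m > 0 \<and>
     (\<forall>r\<ge>0. 0 < g r) \<and> bounded (g ` {0..}) \<and> antimono_on {0..} g \<and>
     ((\<lambda>r. r powr M * g (r powr m)) \<longlongrightarrow> 0) at_top \<and>
     (\<forall>t>0. (\<lambda>(x, y). a t x y) \<in> borel_measurable (\<mu> \<Otimes>\<^sub>M \<mu>)) \<and>
     (\<forall>t>0. \<forall>x\<in>space \<mu>. \<forall>y\<in>space \<mu>.
        cmod (a t x y) \<le> g ((d x y) powr m / t) / measure \<mu> (qball \<mu> d x (t powr (1 / m))))"

definition assumption_A ::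
    "'a measure \<Rightarrow> ('a \<Rightarrow> 'a \<Rightarrow> real) \<Rightarrow> ('a \<Rightarrow> real \<Rightarrow> real) \<Rightarrow> real \<Rightarrow> real \<Rightarrow> (real \<Rightarrow> real) \<Rightarrow>
     (real \<Rightarrow> 'a \<Rightarrow> 'a \<Rightarrow> complex) \<Rightarrow> bool" where
  "assumption_A \<mu> d \<phi> M m g a \<longleftrightarrow>
     gen_approx_identity \<mu> d \<phi> M m g a \<and>
     (\<forall>s\<ge>0. \<forall>t\<ge>0. \<forall>f\<in>MX \<mu> d \<phi> M.
        AE x in \<mu>. op_A \<mu> a t (op_A \<mu> a s f) x = op_A \<mu> a (t + s) f x) \<and>
     M > deg_n \<mu> d + 2 * deg_n \<mu> d * p_index \<mu> d \<phi> / i_index \<mu> \<phi> + deg_N \<mu> d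
         - deg_n \<mu> d * r_ratio (r_index \<mu> d \<phi>) - deg_alpha \<mu> d"


section \<open>The BMO-type spaces\<close>

definition BMO_norm ::
    "'a measure \<Rightarrow> ('a \<Rightarrow> 'a \<Rightarrow> real) \<Rightarrow> ('a \<Rightarrow> real \<Rightarrow> real) \<Rightarrow> real \<Rightarrow>
     (real \<Rightarrow> 'a \<Rightarrow> 'a \<Rightarrow> complex) \<Rightarrow> ('a \<Rightarrow> complex) \<Rightarrow> ennreal" where
  "BMO_norm \<mu> d \<phi> m a f = (SUP (x, r) \<in> space \<mu> \<times> {0<..}.
     (\<integral>\<^sup>+y\<in>qball \<mu> d x r. ennreal (cmod (f y - op_A \<mu> a (r powr m) f y)) \<partial>\<mu>) /
     Lphi_norm \<mu> \<phi> (indicator (qball \<mu> d x r)))"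

definition BMO_max_norm ::
    "'a measure \<Rightarrow> ('a \<Rightarrow> 'a \<Rightarrow> real) \<Rightarrow> ('a \<Rightarrow> real \<Rightarrow> real) \<Rightarrow> real \<Rightarrow>
     (real \<Rightarrow> 'a \<Rightarrow> 'a \<Rightarrow> complex) \<Rightarrow> ('a \<Rightarrow> complex) \<Rightarrow> ennreal" where
  "BMO_max_norm \<mu> d \<phi> m a f = (SUP (t, x) \<in> {0<..} \<times> space \<mu>.
     emeasure \<mu> (qball \<mu> d x (t powr (1 / m))) /
     Lphi_norm \<mu> \<phi> (indicator (qball \<mu> d x (t powr (1 / m)))) *
     ennreal (cmod (op_A \<mu> a t (\<lambda>y. complex_of_real (cmod (f y - op_A \<mu> a t f y))) x)))"

definition BMO ::
    "'a measure \<Rightarrow> ('a \<Rightarrow> 'a \<Rightarrow> real) \<Rightarrow> ('a \<Rightarrow> real \<Rightarrow> real) \<Rightarrow> real \<Rightarrow> real \<Rightarrow>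
     (real \<Rightarrow> 'a \<Rightarrow> 'a \<Rightarrow> complex) \<Rightarrow> ('a \<Rightarrow> complex) set" where
  "BMO \<mu> d \<phi> M m a = {f \<in> MX \<mu> d \<phi> M. BMO_norm \<mu> d \<phi> m a f < \<infinity>}"

definition BMO_max ::
    "'a measure \<Rightarrow> ('a \<Rightarrow> 'a \<Rightarrow> real) \<Rightarrow> ('a \<Rightarrow> real \<Rightarrow> real) \<Rightarrow> real \<Rightarrow> real \<Rightarrow>
     (real \<Rightarrow> 'a \<Rightarrow> 'a \<Rightarrow> complex) \<Rightarrow> ('a \<Rightarrow> complex) set" where
  "BMO_max \<mu> d \<phi> M m a = {f \<in> MX \<mu> d \<phi> M. BMO_max_norm \<mu> d \<phi> m a f < \<infinity>}"

end

theory Submission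
  imports Defs
begin

text \<open>Write \<open>F = |f - A\<^sub>t f|\<close> and \<open>B = B(x, t\<^bsup>1/m\<^esup>)\<close>. The lower bound on the kernel gives
  \<open>C / \<mu>(B) \<integral>\<^sub>B F \<le> A\<^sub>t F(x)\<close>, provided that the integral defining \<open>A\<^sub>t F(x)\<close> converges; this holds
  because the composition of two kernels decays like one kernel as soon as \<open>M > n\<^sub>0 + N\<^sub>0\<close>.

  Conversely, \<open>A\<^sub>t F(x)\<close> is at most a sum of the integrals of \<open>F\<close> over \<open>B(x, 2\<^sup>k t\<^bsup>1/m\<^esup>)\<close> with weights
  \<open>2\<^bsup>-kM\<^esup> / \<mu>(B)\<close>. Each large ball is covered, with bounded overlap, by balls \<open>B\<^sub>j\<close> of the original
  radius, so that the BMO condition on \<open>B\<^sub>j\<close> involves the same operator \<open>A\<^sub>t\<close>. By upper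
  type 1 the norms of the indicators of the \<open>B\<^sub>j\<close> sum up to at most a multiple of the norm of the
  indicator of the large ball, and that norm grows at most like \<open>2\<^bsup>knp/i\<^esup>\<close> by the
  \<open>A\<^sub>p\<close> condition and lower type \<open>i\<close>. The resulting series converges, since Assumption A implies
  \<open>M > n\<^sub>0 p(\<phi>) / i(\<phi>)\<close>.\<close>

text \<open>Three obstacles shape the details. A divergent Bochner integral has the value 0, so the
  lower bound on the kernel says nothing about \<open>op_A\<close> until absolute convergence is
  known; the opposite inequality survives divergence. The numbers \<open>deg_n\<close>,
  \<open>deg_N\<close>, \<open>p_index\<close> and \<open>i_index\<close> are infima and suprema
  that need not be attained, so every strict inequality for \<open>M\<close> is first transferred to
  nearby exponents at which the conditions really hold. Finally, the norms of indicators are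
  extended reals: an infinite norm would make the quotient in \<open>BMO_norm\<close> vanish, and a
  zero norm would make it infinite, so both cases need an argument before an oscillation can be
  recovered from the BMO condition.\<close>

lemma exists_dyadic:
  fixes l :: real
  assumes "l \<ge> 1"
  obtains k :: nat where "l \<le> 2 ^ k" "2 ^ k \<le> 2 * l"
proof -
  define k where "k = (LEAST k::nat. l \<le> 2 ^ k)"
  have "\<exists>k::nat. l \<le> 2 ^ k"
    using real_arch_pow[of 2 l] by (auto intro: less_imp_le)
  then have k: "l \<le> 2 ^ k"
    unfolding k_def by (rule LeastI_ex)
  have "2 ^ k \<le> 2 * l"
  proof (cases k)
    case 0
    then show ?thesis using assms by simp
  next
    case (Suc j)
    then have "\<not> l \<le> 2 ^ j"
      using not_less_Least[of j "\<lambda>k. l \<le> 2 ^ k"] k_def by simp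
    then show ?thesis using Suc by simp
  qed
  with k show ?thesis by (rule that)
qed

section \<open>Spaces of homogeneous type\<close>

text \<open>The parameters are witnesses of the two existential quantifiers in
  \<open>homogeneous_type\<close>: \<open>\<kappa>\<close> is the constant of the quasi-triangle
  inequality and \<open>c\<close> the doubling constant. Fixing them once lets later constants
  depend on them explicitly.\<close>

locale homogeneous_space =
  fixes \<mu> :: "'a measure" and d :: "'a \<Rightarrow> 'a \<Rightarrow> real" and \<kappa> c :: real
  assumes d_nonneg: "x \<in> space \<mu> \<Longrightarrow> y \<in> space \<mu> \<Longrightarrow> 0 \<le> d x y"
    and d_eq_0: "x \<in> space \<mu> \<Longrightarrow> y \<in> space \<mu> \<Longrightarrow> d x y = 0 \<longleftrightarrow> x = y"
    and d_sym: "x \<in> space \<mu> \<Longrightarrow> y \<in> space \<mu> \<Longrightarrow> d x y = d y x"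
    and \<kappa>: "1 \<le> \<kappa>"
    and d_triangle: "x \<in> space \<mu> \<Longrightarrow> y \<in> space \<mu> \<Longrightarrow> z \<in> space \<mu> \<Longrightarrow> d x y \<le> \<kappa> * (d x z + d z y)"
    and ball_sets: "x \<in> space \<mu> \<Longrightarrow> 0 < r \<Longrightarrow> qball \<mu> d x r \<in> sets \<mu>"
    and ball_pos: "x \<in> space \<mu> \<Longrightarrow> 0 < r \<Longrightarrow> 0 < emeasure \<mu> (qball \<mu> d x r)"
    and ball_finite: "x \<in> space \<mu> \<Longrightarrow> 0 < r \<Longrightarrow> emeasure \<mu> (qball \<mu> d x r) < \<infinity>"
    and c: "1 \<le> c"
    and doubling: "x \<in> space \<mu> \<Longrightarrow> 0 < r \<Longrightarrow>
      emeasure \<mu> (qball \<mu> d x (2 * r)) \<le> ennreal c * emeasure \<mu> (qball \<mu> d x r)"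
begin

abbreviation B where "B \<equiv> qball \<mu> d"
abbreviation V where "V x r \<equiv> measure \<mu> (B x r)"

lemma d_self: "x \<in> space \<mu> \<Longrightarrow> d x x = 0"
  by (simp add: d_eq_0)

lemma in_ball: "y \<in> B x r \<longleftrightarrow> y \<in> space \<mu> \<and> d y x < r"
  by (simp add: qball_def)

lemma ball_mono: "r \<le> s \<Longrightarrow> B x r \<subseteq> B x s"
  by (auto simp: in_ball)

lemma emeasure_ball: "x \<in> space \<mu> \<Longrightarrow> 0 < r \<Longrightarrow> emeasure \<mu> (B x r) = ennreal (V x r)"
  using ball_finite[of x r] by (intro emeasure_eq_ennreal_measure) auto

lemma V_pos: "x \<in> space \<mu> \<Longrightarrow> 0 < r \<Longrightarrow> 0 < V x r"
  using ball_pos[of x r] by (simp add: emeasure_ball)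

lemma V_mono:
  assumes "x \<in> space \<mu>" "y \<in> space \<mu>" "0 < r" "0 < s" "B x r \<subseteq> B y s"
  shows "V x r \<le> V y s"
  using emeasure_mono[OF assms(5) ball_sets[OF assms(2,4)]] assms V_pos[of y s]
  by (simp add: emeasure_ball)

lemma ball_subset:
  assumes "x \<in> space \<mu>" "y \<in> space \<mu>" "\<kappa> * (r + d x y) \<le> s"
  shows "B x r \<subseteq> B y s"
proof
  fix z assume "z \<in> B x r"
  then have z: "z \<in> space \<mu>" "d z x < r" by (auto simp: in_ball)
  have "d z y \<le> \<kappa> * (d z x + d x y)" using z assms by (intro d_triangle)
  also have "\<dots> < \<kappa> * (r + d x y)" using z \<kappa> by simp
  also have "\<dots> \<le> s" by (rule assms)
  finally show "z \<in> B y s" using z by (simp add: in_ball)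
qed

lemma V_double: "x \<in> space \<mu> \<Longrightarrow> 0 < r \<Longrightarrow> V x (2 * r) \<le> c * V x r"
  using doubling[of x r] c by (simp add: emeasure_ball flip: ennreal_mult)

lemma V_double_pow:
  assumes "x \<in> space \<mu>" "0 < r"
  shows "V x (2 ^ k * r) \<le> c ^ k * V x r"
proof (induction k)
  case (Suc k)
  have "V x (2 ^ Suc k * r) \<le> c * V x (2 ^ k * r)"
    using V_double[of x "2 ^ k * r"] assms by (simp add: mult.assoc)
  also have "\<dots> \<le> c * (c ^ k * V x r)"
    using Suc c by (intro mult_left_mono) auto
  finally show ?case by (simp add: mult.assoc)
qed simp

text \<open>Balls of integer radii about one point have finite measure and exhaust the space. This
  is what Tonelli's theorem and the measurability of \<open>op_A\<close> rest on.\<close>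

lemma sigma_finite: "sigma_finite_measure \<mu>"
proof (cases "space \<mu> = {}")
  case True
  then show ?thesis
    by (intro sigma_finite_measure.intro exI[of _ "{}"]) auto
next
  case False
  then obtain x where x: "x \<in> space \<mu>" by auto
  show ?thesis
  proof (intro sigma_finite_measure.intro exI[of _ "range (\<lambda>k::nat. B x (real (Suc k)))"] conjI ballI)
    show "\<Union> (range (\<lambda>k. B x (real (Suc k)))) = space \<mu>"
    proof (intro equalityI subsetI)
      fix y assume y: "y \<in> space \<mu>"
      obtain k :: nat where "d y x < real k" using reals_Archimedean2 by blast
      then have "y \<in> B x (real (Suc k))" using y by (simp add: in_ball)
      then show "y \<in> \<Union> (range (\<lambda>k. B x (real (Suc k))))" by blast
    qed (auto simp: in_ball)
    show "range (\<lambda>k. B x (real (Suc k))) \<subseteq> sets \<mu>" using x ball_sets by auto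
  next
    fix E assume "E \<in> range (\<lambda>k. B x (real (Suc k)))"
    then obtain k where "E = B x (real (Suc k))" by blast
    then show "emeasure \<mu> E \<noteq> \<infinity>" using emeasure_ball[OF x, of "real (Suc k)"] by simp
  qed simp
qed

text \<open>The sublevel sets are balls or empty, so the measurability of balls is enough.\<close>

lemma d_measurable: "x \<in> space \<mu> \<Longrightarrow> (\<lambda>y. d y x) \<in> borel_measurable \<mu>"
proof (rule borel_measurableI_less)
  fix r assume x: "x \<in> space \<mu>"
  show "{y \<in> space \<mu>. d y x < r} \<in> sets \<mu>"
  proof (cases "r > 0")
    case True
    then show ?thesis using ball_sets[OF x True] by (simp add: qball_def)
  next
    case False
    then have "{y \<in> space \<mu>. d y x < r} = {}" using d_nonneg x by force
    then show ?thesis by (simp only: sets.empty_sets)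
  qed
qed

section \<open>Exponents for the volume conditions and the degree of the space\<close>

lemma exists_cond_D: "\<exists>n>0. cond_D \<mu> d n"
proof -
  \<comment> \<open>Iterated doubling suggests the exponent \<open>log 2 c\<close>, but this is 0
    for \<open>c = 1\<close>, while \<open>deg_n\<close> ranges over positive exponents only; hence
    \<open>2 * c\<close>.\<close>
  define n where "n = log 2 (2 * c)"
  have n: "n > 0" "2 powr n = 2 * c" using c by (simp_all add: n_def)
  have "V x (l * r) \<le> (2 * c) * l powr n * V x r" if x: "x \<in> space \<mu>" "r > 0" "l \<ge> 1" for x r l
  proof -
    obtain k :: nat where k: "l \<le> 2 ^ k" "2 ^ k \<le> 2 * l" using exists_dyadic x by blast
    have "V x (l * r) \<le> V x (2 ^ k * r)"
      using x k by (intro V_mono ball_mono) (auto simp: mult_right_mono)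
    also have "\<dots> \<le> c ^ k * V x r" using x by (intro V_double_pow)
    also have "c ^ k \<le> (2 * c) ^ k" using c by (intro power_mono) auto
    also have "(2 * c) ^ k = (2 ^ k) powr n"
      by (simp add: n(2)[symmetric] powr_powr powr_powr_swap flip: powr_realpow) (simp add: mult.commute)
    also have "\<dots> \<le> (2 * l) powr n" using k n by (intro powr_mono2) auto
    also have "\<dots> = (2 * c) * l powr n" using x n by (simp add: powr_mult)
    finally show ?thesis by (simp add: mult_right_mono)
  qed
  then show ?thesis using n unfolding cond_D_def by blast
qed

lemma cond_DE:
  assumes "cond_D \<mu> d n"
  obtains K where "K \<ge> 1"
    "\<And>x r l. x \<in> space \<mu> \<Longrightarrow> r > 0 \<Longrightarrow> l \<ge> 1 \<Longrightarrow> V x (l * r) \<le> K * l powr n * V x r"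
proof -
  obtain K where K: "\<And>x r l. x \<in> space \<mu> \<Longrightarrow> r > 0 \<Longrightarrow> l \<ge> 1 \<Longrightarrow> V x (l * r) \<le> K * l powr n * V x r"
    using assms unfolding cond_D_def by blast
  show ?thesis
  proof (rule that[of "max 1 K"])
    fix x and r l :: real assume "x \<in> space \<mu>" "r > 0" "(l::real) \<ge> 1"
    then have "V x (l * r) \<le> K * l powr n * V x r" by (rule K)
    also have "\<dots> \<le> max 1 K * l powr n * V x r" by (intro mult_right_mono) auto
    finally show "V x (l * r) \<le> max 1 K * l powr n * V x r" .
  qed simp
qed

text \<open>The ball about \<open>y\<close> lies in the ball about \<open>x\<close> of radius
  \<open>\<kappa> * (r + d x y)\<close>, which is a dilate of \<open>B x r\<close>. The set defining
  \<open>deg_N\<close> is therefore nonempty, so that its infimum is meaningful.\<close>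

lemma cond_D_imp_cond_E:
  assumes "cond_D \<mu> d n" "n > 0"
  shows "cond_E \<mu> d n"
proof -
  obtain K where K: "K \<ge> 1"
    "\<And>x r l. x \<in> space \<mu> \<Longrightarrow> r > 0 \<Longrightarrow> l \<ge> 1 \<Longrightarrow> V x (l * r) \<le> K * l powr n * V x r"
    using cond_DE[OF assms(1)] by blast
  have "V y r \<le> K * \<kappa> powr n * (1 + d x y / r) powr n * V x r"
    if "x \<in> space \<mu>" "y \<in> space \<mu>" "r > 0" for x y r
  proof -
    have nn: "0 \<le> d x y / r" using that d_nonneg by simp
    have ge: "1 \<le> \<kappa> * (1 + d x y / r)" using mult_mono[of 1 \<kappa> 1 "1 + d x y / r"] \<kappa> nn by simp
    have "V y r \<le> V x (\<kappa> * (1 + d x y / r) * r)"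
    proof (intro V_mono ball_subset)
      show "0 < \<kappa> * (1 + d x y / r) * r" using ge that by simp
      show "\<kappa> * (r + d y x) \<le> \<kappa> * (1 + d x y / r) * r" using that d_sym[of x y]
        by (simp add: field_simps)
    qed (use that in auto)
    also have "\<dots> \<le> K * (\<kappa> * (1 + d x y / r)) powr n * V x r"
      using ge that by (intro K)
    finally show ?thesis using \<kappa> nn by (simp add: powr_mult mult.assoc)
  qed
  then show ?thesis unfolding cond_E_def by blast
qed

lemma cond_EE:
  assumes "cond_E \<mu> d N"
  obtains K where "K \<ge> 1"
    "\<And>x y r. x \<in> space \<mu> \<Longrightarrow> y \<in> space \<mu> \<Longrightarrow> r > 0 \<Longrightarrow> V y r \<le> K * (1 + d x y / r) powr N * V x r"
proof -
  obtain K where K: "\<And>x y r. x \<in> space \<mu> \<Longrightarrow> y \<in> space \<mu> \<Longrightarrow> r > 0 \<Longrightarrow>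
      V y r \<le> K * (1 + d x y / r) powr N * V x r"
    using assms unfolding cond_E_def by blast
  show ?thesis
  proof (rule that[of "max 1 K"])
    fix x y and r :: real assume "x \<in> space \<mu>" "y \<in> space \<mu>" "r > 0"
    then have "V y r \<le> K * (1 + d x y / r) powr N * V x r" by (rule K)
    also have "\<dots> \<le> max 1 K * (1 + d x y / r) powr N * V x r" by (intro mult_right_mono) auto
    finally show "V y r \<le> max 1 K * (1 + d x y / r) powr N * V x r" .
  qed simp
qed

text \<open>For exponent 0 the condition is monotonicity of the measure. It shows that
  \<open>deg_alpha\<close> is a supremum over a nonempty set.\<close>

lemma cond_R_0: "cond_R \<mu> d 0"
proof -
  have "V x r \<le> V x (l * r)" if "x \<in> space \<mu>" "r > 0" "l \<ge> 1" for x r l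
    using that by (intro V_mono ball_mono) auto
  then show ?thesis unfolding cond_R_def by (intro exI[of _ 1]) auto
qed

lemma deg_alpha_le: "deg_alpha \<mu> d \<le> deg_n \<mu> d"
  unfolding deg_alpha_def
proof (rule cSup_least)
  show "{\<alpha>. 0 \<le> \<alpha> \<and> (\<forall>n>0. cond_D \<mu> d n \<longrightarrow> \<alpha> \<le> n) \<and> cond_R \<mu> d \<alpha>} \<noteq> {}"
    using cond_R_0 by (auto intro!: exI[of _ 0])
next
  fix \<alpha> assume "\<alpha> \<in> {\<alpha>. 0 \<le> \<alpha> \<and> (\<forall>n>0. cond_D \<mu> d n \<longrightarrow> \<alpha> \<le> n) \<and> cond_R \<mu> d \<alpha>}"
  then show "\<alpha> \<le> deg_n \<mu> d"
    unfolding deg_n_def using exists_cond_D by (intro cInf_greatest) auto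
qed

lemma deg_n_nonneg: "0 \<le> deg_n \<mu> d"
  unfolding deg_n_def using exists_cond_D by (intro cInf_greatest) auto

text \<open>The infimum need not be attained; strict room above it is traded for an exponent at
  which the condition holds with an actual constant.\<close>

lemma deg_n_less:
  assumes "deg_n \<mu> d < u"
  obtains n where "0 < n" "cond_D \<mu> d n" "n < u"
proof -
  have "\<exists>n\<in>{n. 0 < n \<and> cond_D \<mu> d n}. n < u"
    using assms exists_cond_D unfolding deg_n_def
    by (subst (asm) cInf_less_iff) (auto intro!: bdd_belowI[of _ 0])
  then show ?thesis using that by blast
qed

lemma deg_N_nonneg: "0 \<le> deg_N \<mu> d"
  unfolding deg_N_def using exists_cond_D cond_D_imp_cond_E
  by (intro cInf_greatest) (auto intro: less_imp_le)

lemma deg_N_less: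
  assumes "deg_N \<mu> d < u"
  obtains N where "0 \<le> N" "cond_E \<mu> d N" "N < u"
proof -
  have "\<exists>N\<in>{N. 0 \<le> N \<and> cond_E \<mu> d N}. N < u"
    using assms exists_cond_D cond_D_imp_cond_E unfolding deg_N_def
    by (subst (asm) cInf_less_iff) (auto intro!: bdd_belowI[of _ 0] intro: less_imp_le)
  then show ?thesis using that by blast
qed

section \<open>Separated sets and coverings with bounded overlap\<close>

definition separated :: "real \<Rightarrow> 'a set \<Rightarrow> bool" where
  "separated s P \<longleftrightarrow> finite P \<and> (\<forall>p\<in>P. \<forall>q\<in>P. p \<noteq> q \<longrightarrow> s \<le> d p q)"

text \<open>Balls of a small multiple of \<open>s\<close> about the points of \<open>P\<close> are
  disjoint and lie in one ball about \<open>x\<close>, and by doubling each of them has a fixed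
  share of its measure. The bound depends on \<open>l\<close> but not on \<open>x\<close>,
  \<open>s\<close> or \<open>P\<close>. Finiteness is part of \<open>separated\<close> because
  \<open>card\<close> of an infinite set is 0.\<close>

lemma packing_bound:
  "\<exists>K. \<forall>x\<in>space \<mu>. \<forall>s>0. \<forall>P. P \<subseteq> B x (l * s) \<longrightarrow> separated s P \<longrightarrow> real (card P) \<le> K"
proof -
  obtain n where "0 < n" and n: "cond_D \<mu> d n" using exists_cond_D by blast
  obtain K where K: "K \<ge> 1"
    "\<And>x r l. x \<in> space \<mu> \<Longrightarrow> r > 0 \<Longrightarrow> l \<ge> 1 \<Longrightarrow> V x (l * r) \<le> K * l powr n * V x r"
    using cond_DE[OF n] by blast
  define l' where "l' = max 1 l"
  \<comment> \<open>For the \<open>e\<close> and \<open>R\<close> chosen below,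
    \<open>w * e = \<kappa> * (R + l' * s)\<close>, a radius at which the ball about any point of
    \<open>P\<close> contains \<open>B x R\<close>.\<close>
  define w where "w = 2 * \<kappa> * (\<kappa> * (\<kappa> * (1 + l') + l'))"
  have l': "l' \<ge> 1" "l \<le> l'" by (auto simp: l'_def)
  have k1: "1 + l' \<le> \<kappa> * (1 + l')" using \<kappa> l' by simp
  have "1 * 1 \<le> \<kappa> * (\<kappa> * (1 + l') + l')" using \<kappa> l' k1 by (intro mult_mono) linarith+
  then have w1: "1 \<le> w" unfolding w_def using \<kappa> mult_mono[of 1 "2 * \<kappa>" 1 "\<kappa> * (\<kappa> * (1 + l') + l')"] by simp
  show ?thesis
  proof (intro exI[of _ "K * w powr n"] ballI allI impI)
    fix x s P
    assume x: "x \<in> space \<mu>" and s: "s > 0" and PB: "P \<subseteq> B x (l * s)" and "separated s P"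
    then have P: "finite P" "P \<subseteq> B x (l * s)"
      and sep: "\<And>p q. p \<in> P \<Longrightarrow> q \<in> P \<Longrightarrow> p \<noteq> q \<Longrightarrow> s \<le> d p q"
      by (auto simp: separated_def)
    \<comment> \<open>A common point of two balls of radius \<open>e\<close> would put their centres
      at distance less than \<open>2 * \<kappa> * e = s\<close>.\<close>
    define e where "e = s / (2 * \<kappa>)"
    define R where "R = \<kappa> * (1 + l') * s"
    have e: "0 < e" "e \<le> s" "2 * \<kappa> * e = s" using s \<kappa> by (auto simp: e_def field_simps)
    have R: "0 < R" unfolding R_def using \<kappa> l' s by simp
    have Psp: "p \<in> space \<mu>" "d p x \<le> l' * s" if "p \<in> P" for p
    proof -
      have "p \<in> space \<mu>" "d p x < l * s" using that P by (auto simp: in_ball)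
      moreover have "l * s \<le> l' * s" using l' s by (intro mult_right_mono) auto
      ultimately show "p \<in> space \<mu>" "d p x \<le> l' * s" by linarith+
    qed
    have V1: "V x R \<le> (K * w powr n) * V p e" if p: "p \<in> P" for p
    proof -
      have "V x R \<le> V p (w * e)"
      proof (intro V_mono ball_subset)
        have "w * e = \<kappa> * (R + l' * s)" by (simp add: w_def R_def algebra_simps flip: e(3))
        then show "\<kappa> * (R + d x p) \<le> w * e"
          using Psp[OF p] d_sym[of p x] x \<kappa> by (simp add: mult_left_mono)
      qed (use x p Psp R w1 e in auto)
      also have "\<dots> \<le> K * w powr n * V p e" using w1 e Psp[OF p] by (intro K)
      finally show ?thesis .
    qed
    have sub: "B p e \<subseteq> B x R" if p: "p \<in> P" for p
    proof (rule ball_subset)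
      have "e + d p x \<le> (1 + l') * s" using e Psp[OF p] by (simp add: algebra_simps)
      then show "\<kappa> * (e + d p x) \<le> R" unfolding R_def using \<kappa> by (simp add: mult.assoc mult_left_mono)
    qed (use x Psp p in auto)
    have disj: "disjoint_family_on (\<lambda>p. B p e) P"
      unfolding disjoint_family_on_def
    proof (intro ballI impI)
      fix p q assume pq: "p \<in> P" "q \<in> P" "p \<noteq> q"
      show "B p e \<inter> B q e = {}"
      proof (rule ccontr)
        assume "B p e \<inter> B q e \<noteq> {}"
        then obtain z where z: "z \<in> space \<mu>" "d z p < e" "d z q < e" by (auto simp: in_ball)
        have "d p q \<le> \<kappa> * (d p z + d z q)" using z Psp pq by (intro d_triangle) auto
        also have "\<dots> < \<kappa> * (e + e)" using z d_sym[of p z] Psp pq \<kappa> by (intro mult_strict_left_mono) auto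
        finally show False using sep[OF pq] e by simp
      qed
    qed
    have "real (card P) * V x R = (\<Sum>p\<in>P. V x R)" by simp
    also have "\<dots> \<le> (\<Sum>p\<in>P. (K * w powr n) * V p e)" by (intro sum_mono V1)
    also have "\<dots> = (K * w powr n) * measure \<mu> (\<Union>p\<in>P. B p e)"
      using P disj Psp e ball_sets ball_finite
      by (subst measure_finite_Union) (auto simp: sum_distrib_left less_top)
    also have "\<dots> \<le> (K * w powr n) * V x R"
    proof (intro mult_left_mono measure_mono_fmeasurable)
      show "B x R \<in> fmeasurable \<mu>" using x R ball_sets ball_finite by (intro fmeasurableI) auto
      show "(\<Union>p\<in>P. B p e) \<in> sets \<mu>" using P Psp e ball_sets by (intro sets.finite_UN) auto
    qed (use sub K in auto)
    finally show "real (card P) \<le> K * w powr n" using V_pos[OF x R] by simp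
  qed
qed

text \<open>An \<open>s\<close>-separated subset of \<open>B x R\<close> of largest cardinality
  covers, since an uncovered point could be added to it. The centres whose balls contain a given
  \<open>y\<close> are \<open>s\<close>-separated and lie in \<open>B y s\<close>, so their number
  is bounded independently of \<open>R\<close>.\<close>

lemma covering:
  "\<exists>K::real. \<forall>x\<in>space \<mu>. \<forall>s>0. \<forall>R>0.
    \<exists>P. finite P \<and> P \<subseteq> B x R \<and> B x R \<subseteq> (\<Union>p\<in>P. B p s) \<and>
      (\<forall>y\<in>space \<mu>. real (card {p \<in> P. y \<in> B p s}) \<le> K)"
proof -
  obtain K where K: "\<forall>x\<in>space \<mu>. \<forall>s>0. \<forall>P. P \<subseteq> B x (1 * s) \<longrightarrow> separated s P \<longrightarrow> real (card P) \<le> K"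
    using packing_bound[of 1] by (rule exE)
  show ?thesis
  proof (intro exI[of _ K] ballI allI impI)
    fix x and s R :: real assume x: "x \<in> space \<mu>" "s > 0" "R > 0"
    define Sep where "Sep P \<longleftrightarrow> P \<subseteq> B x R \<and> separated s P" for P
    \<comment> \<open>\<open>K'\<close> depends on \<open>R / s\<close>, but it serves only to
      ensure that a largest separated set exists; the overlap is counted with
      \<open>K\<close>.\<close>
    obtain K' where K': "\<forall>x\<in>space \<mu>. \<forall>e>0. \<forall>P. P \<subseteq> B x (R / s * e) \<longrightarrow> separated e P \<longrightarrow> real (card P) \<le> K'"
      using packing_bound[of "R / s"] by (rule exE)
    have bound: "card P < Suc (nat \<lceil>K'\<rceil>)" if "Sep P" for P
    proof -
      have "P \<subseteq> B x (R / s * s)" "separated s P" using that x by (auto simp: Sep_def)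
      then have "real (card P) \<le> K'" using K' x by blast
      then show ?thesis by linarith
    qed
    have "Sep {}" by (simp add: Sep_def separated_def)
    then have "\<exists>P. Sep P \<and> (\<forall>Q. Sep Q \<longrightarrow> card Q \<le> card P)"
      using bound by (intro ex_has_greatest_nat[of Sep "{}" card "Suc (nat \<lceil>K'\<rceil>)"]) (auto intro: less_imp_le)
    then obtain P where P: "Sep P" and max: "\<And>Q. Sep Q \<Longrightarrow> card Q \<le> card P" by blast
    have "B x R \<subseteq> (\<Union>p\<in>P. B p s)"
    proof (rule ccontr)
      assume "\<not> B x R \<subseteq> (\<Union>p\<in>P. B p s)"
      then obtain y where y: "y \<in> B x R" "\<And>p. p \<in> P \<Longrightarrow> y \<notin> B p s" by blast
      have sp: "y \<in> space \<mu>" "\<And>p. p \<in> P \<Longrightarrow> p \<in> space \<mu>" using y P by (auto simp: Sep_def in_ball)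
      have fin: "finite P" using P by (simp add: Sep_def separated_def)
      have yp: "s \<le> d y p" "s \<le> d p y" if "p \<in> P" for p
        using y(2)[OF that] sp that d_sym[of y p] by (auto simp: in_ball)
      have "y \<notin> P" using yp(1)[of y] d_self[OF sp(1)] x by auto
      have "Sep (insert y P)" using P y yp by (auto simp: Sep_def separated_def)
      from max[OF this] show False using \<open>y \<notin> P\<close> fin by simp
    qed
    moreover have "real (card {p \<in> P. y \<in> B p s}) \<le> K" if y: "y \<in> space \<mu>" for y
    proof -
      have "{p \<in> P. y \<in> B p s} \<subseteq> B y (1 * s)" using P y by (auto simp: in_ball Sep_def d_sym)
      moreover have "separated s {p \<in> P. y \<in> B p s}" using P by (auto simp: Sep_def separated_def)
      ultimately show ?thesis using K x(2) y by blast
    qed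
    ultimately show "\<exists>P. finite P \<and> P \<subseteq> B x R \<and> B x R \<subseteq> (\<Union>p\<in>P. B p s) \<and>
      (\<forall>y\<in>space \<mu>. real (card {p \<in> P. y \<in> B p s}) \<le> K)"
      using P by (auto simp: Sep_def separated_def)
  qed
qed

end

section \<open>Kernels with polynomial decay\<close>

text \<open>One term of the sum is enough, namely the one for \<open>k\<close> with
  \<open>1 + r \<le> 2 ^ k \<le> 2 * (1 + r)\<close>. The whole series is kept because the
  right-hand side can be integrated term by term without choosing \<open>k\<close>
  measurably.\<close>

lemma powr_decay_le_dyadic_sum:
  fixes r \<tau> :: real
  assumes "0 \<le> r" "0 < \<tau>"
  shows "ennreal ((1 + r) powr - \<tau>) \<le>
    (\<Sum>k. ennreal (2 powr \<tau> * (2 powr - \<tau>) ^ k) * indicator {..<2 ^ k} r)"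
proof -
  define h :: "nat \<Rightarrow> ennreal" where
    "h k = ennreal (2 powr \<tau> * (2 powr - \<tau>) ^ k) * indicator {..<2 ^ k} r" for k
  obtain k :: nat where k: "1 + r \<le> 2 ^ k" "2 ^ k \<le> 2 * (1 + r)"
    using exists_dyadic[of "1 + r"] assms by auto
  have "(1 + r) powr - \<tau> \<le> (2 ^ k / 2) powr - \<tau>"
    using k assms by (intro powr_mono2') auto
  also have "\<dots> = 2 powr \<tau> * (2 powr - \<tau>) ^ k"
    by (simp add: powr_divide powr_minus_divide powr_power powr_powr powr_realpow[symmetric]
        mult.commute power_one_over)
  finally have "ennreal ((1 + r) powr - \<tau>) \<le> h k"
    using k by (simp add: h_def ennreal_leI)
  also have "h k = sum h {k}" by simp
  also have "\<dots> \<le> suminf h" by (intro sum_le_suminf) auto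
  finally show ?thesis unfolding h_def[abs_def] .
qed

context homogeneous_space
begin

text \<open>Growth of order \<open>\<sigma>\<close> of the integrals over dyadic balls against decay
  of order \<open>\<tau>\<close> leaves a geometric series of ratio
  \<open>2 powr (\<sigma> - \<tau>)\<close>. It is applied with \<open>F = 1\<close> and
  \<open>\<sigma> = n\<close>, and with the oscillation of a function and
  \<open>\<sigma> = n * p / i\<close>.\<close>

lemma nn_integral_decay:
  fixes F :: "'a \<Rightarrow> ennreal"
  assumes x: "x \<in> space \<mu>" and s: "0 < s" and \<sigma>: "0 \<le> \<sigma>" "\<sigma> < \<tau>"
    and F[measurable]: "F \<in> borel_measurable \<mu>"
    and bound: "\<And>k. (\<integral>\<^sup>+y\<in>B x (2 ^ k * s). F y \<partial>\<mu>) \<le> D * ennreal ((2 ^ k) powr \<sigma>)"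
  shows "(\<integral>\<^sup>+y. ennreal ((1 + d y x / s) powr - \<tau>) * F y \<partial>\<mu>)
    \<le> ennreal (2 powr \<tau> / (1 - 2 powr (\<sigma> - \<tau>))) * D"
proof -
  let ?b = "\<lambda>k::nat. 2 powr \<tau> * (2 powr - \<tau>) ^ k :: real"
  define w :: real where "w = 2 powr (\<sigma> - \<tau>)"
  have w: "0 < w" "w < 1" using \<sigma> by (auto simp: w_def powr_less_one)
  have [measurable]: "B x (2 ^ k * s) \<in> sets \<mu>" for k using x s ball_sets by simp
  have "(\<integral>\<^sup>+y. ennreal ((1 + d y x / s) powr - \<tau>) * F y \<partial>\<mu>)
    \<le> (\<integral>\<^sup>+y. (\<Sum>k. ennreal (?b k) * (F y * indicator (B x (2 ^ k * s)) y)) \<partial>\<mu>)"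
  proof (rule nn_integral_mono)
    fix y assume y: "y \<in> space \<mu>"
    have ind: "indicator {..<2 ^ k} (d y x / s) = (indicator (B x (2 ^ k * s)) y :: ennreal)" for k
      using y s by (simp add: in_ball indicator_def pos_divide_less_eq)
    have "ennreal ((1 + d y x / s) powr - \<tau>) * F y
        \<le> (\<Sum>k. ennreal (?b k) * indicator {..<2 ^ k} (d y x / s)) * F y"
      using x y s \<sigma> d_nonneg by (intro mult_right_mono powr_decay_le_dyadic_sum) auto
    also have "\<dots> = (\<Sum>k. ennreal (?b k) * indicator {..<2 ^ k} (d y x / s) * F y)"
      by simp
    finally show "ennreal ((1 + d y x / s) powr - \<tau>) * F y
        \<le> (\<Sum>k. ennreal (?b k) * (F y * indicator (B x (2 ^ k * s)) y))"
      unfolding ind by (simp add: mult_ac)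
  qed
  also have "\<dots> = (\<Sum>k. ennreal (?b k) * (\<integral>\<^sup>+y\<in>B x (2 ^ k * s). F y \<partial>\<mu>))"
    by (simp add: nn_integral_suminf nn_integral_cmult)
  also have "\<dots> \<le> (\<Sum>k. ennreal (?b k) * (D * ennreal ((2 ^ k) powr \<sigma>)))"
    by (intro suminf_le mult_left_mono bound) auto
  also have "\<dots> = (\<Sum>k. ennreal (2 powr \<tau> * w ^ k) * D)"
  proof (rule suminf_cong)
    fix k :: nat
    have "?b k * (2 ^ k) powr \<sigma> = 2 powr \<tau> * w ^ k"
      by (simp add: w_def powr_power powr_diff powr_minus powr_realpow[symmetric] powr_powr
          field_simps flip: powr_add)
    then show "ennreal (?b k) * (D * ennreal ((2 ^ k) powr \<sigma>)) = ennreal (2 powr \<tau> * w ^ k) * D"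
      by (metis (no_types, opaque_lifting) ennreal_mult'' mult.assoc mult.commute powr_ge_zero)
  qed
  also have "\<dots> = (\<Sum>k. ennreal (2 powr \<tau> * w ^ k)) * D" by simp
  also have "(\<Sum>k. ennreal (2 powr \<tau> * w ^ k)) = ennreal (2 powr \<tau> * (1 / (1 - w)))"
    using w by (intro suminf_ennreal_eq sums_mult geometric_sums) auto
  finally show ?thesis by (simp add: w_def)
qed

lemma nn_integral_decay_one:
  assumes n: "cond_D \<mu> d n" "0 \<le> n" "n < \<tau>"
  shows "\<exists>K\<ge>0. \<forall>x\<in>space \<mu>. \<forall>s>0.
    (\<integral>\<^sup>+y. ennreal ((1 + d y x / s) powr - \<tau>) \<partial>\<mu>) \<le> ennreal (K * V x s)"
proof -
  obtain K where K: "K \<ge> 1"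
    "\<And>x r l. x \<in> space \<mu> \<Longrightarrow> r > 0 \<Longrightarrow> l \<ge> 1 \<Longrightarrow> V x (l * r) \<le> K * l powr n * V x r"
    using cond_DE[OF n(1)] by blast
  define c0 where "c0 = 2 powr \<tau> / (1 - 2 powr (n - \<tau>))"
  have c0: "c0 \<ge> 0" using n by (simp add: c0_def powr_le_one_le less_imp_le powr_less_one)
  show ?thesis
  proof (intro exI[of _ "c0 * K"] conjI ballI allI impI)
    fix x and s :: real assume x: "x \<in> space \<mu>" "s > 0"
    have "(\<integral>\<^sup>+y. ennreal ((1 + d y x / s) powr - \<tau>) * 1 \<partial>\<mu>) \<le> ennreal c0 * ennreal (K * V x s)"
      unfolding c0_def
    proof (rule nn_integral_decay)
      fix k :: nat
      have "(\<integral>\<^sup>+y\<in>B x (2 ^ k * s). 1 \<partial>\<mu>) = ennreal (V x (2 ^ k * s))"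
        using x ball_sets by (simp add: emeasure_ball)
      also have "\<dots> \<le> ennreal (K * (2 ^ k) powr n * V x s)"
        using x by (intro ennreal_leI K) auto
      also have "\<dots> = ennreal (K * V x s) * ennreal ((2 ^ k) powr n)"
        using K by (simp add: mult_ac flip: ennreal_mult)
      finally show "(\<integral>\<^sup>+y\<in>B x (2 ^ k * s). 1 \<partial>\<mu>) \<le> ennreal (K * V x s) * ennreal ((2 ^ k) powr n)" .
    qed (use x n in auto)
    also have "\<dots> = ennreal (c0 * K * V x s)"
      using c0 K by (simp add: mult.assoc flip: ennreal_mult)
    finally show "(\<integral>\<^sup>+y. ennreal ((1 + d y x / s) powr - \<tau>) \<partial>\<mu>) \<le> ennreal (c0 * K * V x s)" by simp
  qed (use c0 K in auto)
qed

text \<open>By the quasi-triangle inequality, \<open>y\<close> cannot be close to both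
  \<open>x\<close> and \<open>z\<close>: the larger of the two normalized distances is at least a
  fixed multiple of that from \<open>z\<close> to \<open>x\<close>, and its factor supplies the
  decay on the right. The remaining factor is integrated after \<open>V y s\<close> has been
  exchanged for the volume at a fixed centre, which costs \<open>N\<close> powers of the decay and
  leaves \<open>M - N > n\<close>.\<close>

lemma decay_convolution:
  assumes n: "cond_D \<mu> d n" "0 \<le> n" and N: "cond_E \<mu> d N" "0 \<le> N" and M: "n + N < M"
  shows "\<exists>K\<ge>0. \<forall>s>0. \<forall>x\<in>space \<mu>. \<forall>z\<in>space \<mu>.
    (\<integral>\<^sup>+y. ennreal ((1 + d y x / s) powr - M * ((1 + d z y / s) powr - M / V y s)) \<partial>\<mu>)
      \<le> ennreal (K * (1 + d z x / s) powr - M)"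
proof -
  obtain E where E: "E \<ge> 1"
    "\<And>x y r. x \<in> space \<mu> \<Longrightarrow> y \<in> space \<mu> \<Longrightarrow> r > 0 \<Longrightarrow> V y r \<le> E * (1 + d x y / r) powr N * V x r"
    using cond_EE[OF N(1)] by blast
  obtain K where K: "K \<ge> 0" "\<And>x s. x \<in> space \<mu> \<Longrightarrow> s > 0 \<Longrightarrow>
    (\<integral>\<^sup>+y. ennreal ((1 + d y x / s) powr - (M - N)) \<partial>\<mu>) \<le> ennreal (K * V x s)"
    using nn_integral_decay_one[of n "M - N"] n M by auto
  define A where "A = (2 * \<kappa>) powr M * E"
  have A: "A \<ge> 0" using E by (simp add: A_def)
  show ?thesis
  proof (intro exI[of _ "2 * A * K"] conjI ballI allI impI)
    fix s :: real and x z assume s: "s > 0" and x: "x \<in> space \<mu>" and z: "z \<in> space \<mu>"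
    define W where "W = 1 + d z x / s"
    define h where "h u y = (1 + d y u / s) powr - (M - N) / V u s" for u y
    have V: "V x s > 0" "V z s > 0" using V_pos x z s by auto
    have W: "W \<ge> 1" using d_nonneg[OF z x] s by (simp add: W_def)
    have pw: "(1 + d y x / s) powr - M * ((1 + d z y / s) powr - M / V y s)
        \<le> A * W powr - M * (h z y + h x y)" if y: "y \<in> space \<mu>" for y
    proof -
      define X where "X = 1 + d y x / s"
      define Z where "Z = 1 + d y z / s"
      have Z': "1 + d z y / s = Z" using d_sym[OF y z] by (simp add: Z_def)
      have XZ: "X \<ge> 1" "Z \<ge> 1" using d_nonneg x y z s by (auto simp: X_def Z_def)
      have Vy: "V y s > 0" using V_pos y s by auto
      have hh: "h x y = X powr (N - M) / V x s" "h z y = Z powr (N - M) / V z s"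
        by (simp_all add: h_def X_def Z_def)
      \<comment> \<open>Condition (E_N) moves the volume from \<open>y\<close> to the fixed centre
        \<open>u\<close>, raising the exponent from \<open>- M\<close> to
        \<open>N - M\<close>.\<close>
      have inv: "U powr - M / V y s \<le> E * (U powr (N - M) / V u s)"
        if u: "u \<in> space \<mu>" and U: "U = 1 + d y u / s" for u U
      proof -
        have U1: "U \<ge> 1" using U d_nonneg[OF y u] s by simp
        have "U powr - M * V u s \<le> U powr - M * (E * U powr N * V y s)"
          using E(2)[OF y u s] unfolding U by (intro mult_left_mono) auto
        also have "\<dots> = E * U powr (N - M) * V y s" using U1 by (simp add: powr_diff powr_minus field_simps)
        finally show ?thesis using Vy V_pos[OF u s] by (simp add: field_simps)
      qed
      have d: "d z x / s \<le> \<kappa> * (d y z / s + d y x / s)"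
        using d_triangle[OF z x y] d_sym[OF y z] s by (simp add: field_simps)
      have "W \<le> \<kappa> * (X + Z)" using d \<kappa> unfolding W_def X_def Z_def by (simp add: algebra_simps)
      also have "\<dots> \<le> \<kappa> * (2 * max X Z)" using \<kappa> by (intro mult_left_mono) auto
      finally have WXZ: "W / (2 * \<kappa>) \<le> max X Z" using \<kappa> by (simp add: field_simps)
      have big: "U powr - M \<le> (2 * \<kappa>) powr M * W powr - M" if "W / (2 * \<kappa>) \<le> U" for U
      proof -
        have "U powr - M \<le> (W / (2 * \<kappa>)) powr - M"
          using that W \<kappa> M n N by (intro powr_mono2') auto
        also have "\<dots> = (2 * \<kappa>) powr M * W powr - M"
          using W \<kappa> by (simp add: powr_divide powr_minus_divide)
        finally show ?thesis .
      qed
      have hp: "0 \<le> h x y" "0 \<le> h z y" by (auto simp: h_def)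
      show ?thesis
      proof (cases "X \<le> Z")
        case True
        have "X powr - M * (Z powr - M / V y s) = Z powr - M * (X powr - M / V y s)" by simp
        also have "\<dots> \<le> ((2 * \<kappa>) powr M * W powr - M) * (X powr - M / V y s)"
          using big[of Z] WXZ Vy True by (intro mult_right_mono) auto
        also have "\<dots> \<le> ((2 * \<kappa>) powr M * W powr - M) * (E * h x y)"
          using inv[OF x X_def] by (intro mult_left_mono) (auto simp: hh)
        also have "\<dots> = A * W powr - M * h x y" by (simp add: A_def mult_ac)
        also have "\<dots> \<le> A * W powr - M * (h z y + h x y)" using hp A by (intro mult_left_mono) auto
        finally show ?thesis unfolding Z' X_def .
      next
        case False
        then have "X powr - M * (Z powr - M / V y s) \<le> ((2 * \<kappa>) powr M * W powr - M) * (Z powr - M / V y s)"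
          using big[of X] WXZ Vy by (intro mult_right_mono) auto
        also have "\<dots> \<le> ((2 * \<kappa>) powr M * W powr - M) * (E * h z y)"
          using inv[OF z Z_def] by (intro mult_left_mono) (auto simp: hh)
        also have "\<dots> = A * W powr - M * h z y" by (simp add: A_def mult_ac)
        also have "\<dots> \<le> A * W powr - M * (h z y + h x y)" using hp A by (intro mult_left_mono) auto
        finally show ?thesis unfolding Z' X_def .
      qed
    qed
    have hm: "(\<lambda>y. ennreal (h u y)) \<in> borel_measurable \<mu>" if "u \<in> space \<mu>" for u
      using d_measurable[OF that, measurable] unfolding h_def by measurable
    have hi: "(\<integral>\<^sup>+y. ennreal (h u y) \<partial>\<mu>) \<le> ennreal K" if u: "u \<in> space \<mu>" for u
    proof -
      note [measurable] = d_measurable[OF u]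
      have Vu: "V u s > 0" using V_pos u s by auto
      have "(\<integral>\<^sup>+y. ennreal (h u y) \<partial>\<mu>)
          = (\<integral>\<^sup>+y. ennreal (1 / V u s) * ennreal ((1 + d y u / s) powr - (M - N)) \<partial>\<mu>)"
        by (simp add: h_def flip: ennreal_mult)
      also have "\<dots> = ennreal (1 / V u s) * (\<integral>\<^sup>+y. ennreal ((1 + d y u / s) powr - (M - N)) \<partial>\<mu>)"
        by (intro nn_integral_cmult) measurable
      also have "\<dots> \<le> ennreal (1 / V u s) * ennreal (K * V u s)"
        using K(2)[OF u s] by (intro mult_left_mono) auto
      also have "\<dots> = ennreal K" using Vu K by (simp flip: ennreal_mult)
      finally show ?thesis .
    qed
    \<comment> \<open>Only monotonicity is applied to the integral on the left, since measurability
      of \<open>V y s\<close> in \<open>y\<close> has not been established. The bounding functions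
      \<open>h\<close> have fixed centres and are measurable.\<close>
    have "(\<integral>\<^sup>+y. ennreal ((1 + d y x / s) powr - M * ((1 + d z y / s) powr - M / V y s)) \<partial>\<mu>)
      \<le> (\<integral>\<^sup>+y. ennreal (A * W powr - M) * (ennreal (h z y) + ennreal (h x y)) \<partial>\<mu>)"
    proof (rule nn_integral_mono)
      fix y assume y: "y \<in> space \<mu>"
      have "ennreal (A * W powr - M) * (ennreal (h z y) + ennreal (h x y))
        = ennreal (A * W powr - M * (h z y + h x y))"
        using A by (simp add: h_def flip: ennreal_mult ennreal_plus)
      then show "ennreal ((1 + d y x / s) powr - M * ((1 + d z y / s) powr - M / V y s))
        \<le> ennreal (A * W powr - M) * (ennreal (h z y) + ennreal (h x y))"
        using pw[OF y] by (simp add: ennreal_leI)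
    qed
    also have "\<dots> = ennreal (A * W powr - M) * ((\<integral>\<^sup>+y. ennreal (h z y) \<partial>\<mu>) + (\<integral>\<^sup>+y. ennreal (h x y) \<partial>\<mu>))"
      using hm[OF x] hm[OF z] by (simp add: nn_integral_cmult nn_integral_add)
    also have "\<dots> \<le> ennreal (A * W powr - M) * (ennreal K + ennreal K)"
      by (intro mult_left_mono add_mono hi x z) auto
    also have "\<dots> = ennreal (2 * A * K * W powr - M)"
      using A K by (simp add: mult_ac flip: ennreal_mult ennreal_plus)
    finally show "(\<integral>\<^sup>+y. ennreal ((1 + d y x / s) powr - M * ((1 + d z y / s) powr - M / V y s)) \<partial>\<mu>)
      \<le> ennreal (2 * A * K * (1 + d z x / s) powr - M)" by (simp add: W_def)
  qed (use A K in auto)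
qed

section \<open>Measurability and absolute convergence of iterated integrals\<close>

lemma integral_kernel_measurable:
  fixes k :: "'a \<Rightarrow> 'a \<Rightarrow> complex" and f :: "'a \<Rightarrow> complex"
  assumes [measurable]: "(\<lambda>(x, y). k x y) \<in> borel_measurable (\<mu> \<Otimes>\<^sub>M \<mu>)" "f \<in> borel_measurable \<mu>"
  shows "(\<lambda>x. LINT y|\<mu>. k x y * f y) \<in> borel_measurable \<mu>"
proof -
  interpret sigma_finite_measure \<mu> by (rule sigma_finite)
  show ?thesis by measurable
qed

text \<open>The iterated kernel is dominated by the kernel bound itself, so Tonelli's theorem applies.\<close>

lemma integrable_kernel_oscillation:
  fixes k :: "'a \<Rightarrow> 'a \<Rightarrow> complex" and f :: "'a \<Rightarrow> complex"
  assumes n: "cond_D \<mu> d n" "0 \<le> n" and N: "cond_E \<mu> d N" "0 \<le> N" and M: "n + N < M"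
    and k[measurable]: "(\<lambda>(x, y). k x y) \<in> borel_measurable (\<mu> \<Otimes>\<^sub>M \<mu>)"
    and f[measurable]: "f \<in> borel_measurable \<mu>"
    and s: "0 < s" and G: "0 \<le> G"
    and k_le: "\<And>x y. x \<in> space \<mu> \<Longrightarrow> y \<in> space \<mu> \<Longrightarrow>
      cmod (k x y) \<le> G * ((1 + d y x / s) powr - M / V x s)"
    and x: "x \<in> space \<mu>"
    and fin: "(\<integral>\<^sup>+z. ennreal ((1 + d z x / s) powr - M) * ennreal (cmod (f z)) \<partial>\<mu>) < \<infinity>"
  shows "integrable \<mu> (\<lambda>y. k x y * complex_of_real (cmod (f y - (LINT z|\<mu>. k y z * f z))))"
proof -
  interpret sigma_finite_measure \<mu> by (rule sigma_finite)
  interpret P: pair_sigma_finite \<mu> \<mu> ..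
  obtain K where K: "K \<ge> 0" "\<And>z. z \<in> space \<mu> \<Longrightarrow>
    (\<integral>\<^sup>+y. ennreal ((1 + d y x / s) powr - M * ((1 + d z y / s) powr - M / V y s)) \<partial>\<mu>)
      \<le> ennreal (K * (1 + d z x / s) powr - M)"
    using decay_convolution[OF n N M] s x by blast
  note [measurable] = d_measurable[OF x]
  have [measurable]: "(\<lambda>y. k x y) \<in> borel_measurable \<mu>"
    using measurable_compose[OF measurable_Pair1'[OF x] k] by simp
  have Vx: "V x s > 0" using V_pos x s by auto
  let ?J = "\<integral>\<^sup>+z. ennreal ((1 + d z x / s) powr - M) * ennreal (cmod (f z)) \<partial>\<mu>"
  have I1: "(\<integral>\<^sup>+y. ennreal (cmod (k x y)) * ennreal (cmod (f y)) \<partial>\<mu>) < \<infinity>"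
  proof -
    have "(\<integral>\<^sup>+y. ennreal (cmod (k x y)) * ennreal (cmod (f y)) \<partial>\<mu>)
      \<le> (\<integral>\<^sup>+y. ennreal (G / V x s) * (ennreal ((1 + d y x / s) powr - M) * ennreal (cmod (f y))) \<partial>\<mu>)"
    proof (rule nn_integral_mono)
      fix y assume y: "y \<in> space \<mu>"
      have "ennreal (cmod (k x y)) \<le> ennreal (G / V x s) * ennreal ((1 + d y x / s) powr - M)"
        using k_le[OF x y] G Vx by (simp add: ennreal_leI flip: ennreal_mult)
      then show "ennreal (cmod (k x y)) * ennreal (cmod (f y))
        \<le> ennreal (G / V x s) * (ennreal ((1 + d y x / s) powr - M) * ennreal (cmod (f y)))"
        unfolding mult.assoc[symmetric] by (intro mult_right_mono) auto
    qed
    also have "\<dots> = ennreal (G / V x s) * ?J" by (intro nn_integral_cmult) measurable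
    also have "\<dots> < \<infinity>" using fin by (simp add: ennreal_mult_less_top)
    finally show ?thesis .
  qed
  have I2: "(\<integral>\<^sup>+y. (\<integral>\<^sup>+z. ennreal (cmod (k x y)) * (ennreal (cmod (k y z)) * ennreal (cmod (f z))) \<partial>\<mu>) \<partial>\<mu>) < \<infinity>"
  proof -
    have "(\<integral>\<^sup>+y. (\<integral>\<^sup>+z. ennreal (cmod (k x y)) * (ennreal (cmod (k y z)) * ennreal (cmod (f z))) \<partial>\<mu>) \<partial>\<mu>)
      = (\<integral>\<^sup>+z. (\<integral>\<^sup>+y. ennreal (cmod (k x y)) * (ennreal (cmod (k y z)) * ennreal (cmod (f z))) \<partial>\<mu>) \<partial>\<mu>)"
      by (rule P.Fubini') measurable
    also have "\<dots> \<le> (\<integral>\<^sup>+z. ennreal (G * G / V x s * K) * (ennreal ((1 + d z x / s) powr - M) * ennreal (cmod (f z))) \<partial>\<mu>)"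
    proof (rule nn_integral_mono)
      fix z assume z: "z \<in> space \<mu>"
      have [measurable]: "(\<lambda>y. k y z) \<in> borel_measurable \<mu>"
        using measurable_compose[OF measurable_Pair2'[OF z] k] by simp
      have "(\<integral>\<^sup>+y. ennreal (cmod (k x y)) * (ennreal (cmod (k y z)) * ennreal (cmod (f z))) \<partial>\<mu>)
        = (\<integral>\<^sup>+y. ennreal (cmod (k x y) * cmod (k y z)) \<partial>\<mu>) * ennreal (cmod (f z))"
        by (subst nn_integral_multc[symmetric]) (auto simp: ennreal_mult mult.assoc)
      also have "(\<integral>\<^sup>+y. ennreal (cmod (k x y) * cmod (k y z)) \<partial>\<mu>)
        \<le> ennreal (G * G / V x s * K) * ennreal ((1 + d z x / s) powr - M)"
      proof -
        \<comment> \<open>The constant is extracted while the integrand is still a product of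
          kernels, hence measurable; the profile containing \<open>V y s\<close> is reached
          afterwards by monotonicity alone. For \<open>G = 0\<close> the kernel vanishes and the
          division by 0 does no harm.\<close>
        have "(\<integral>\<^sup>+y. ennreal (cmod (k x y) * cmod (k y z)) \<partial>\<mu>)
          = (\<integral>\<^sup>+y. ennreal (G * G / V x s) * ennreal (cmod (k x y) * cmod (k y z) / (G * G / V x s)) \<partial>\<mu>)"
        proof (rule nn_integral_cong)
          fix y assume y: "y \<in> space \<mu>"
          show "ennreal (cmod (k x y) * cmod (k y z))
            = ennreal (G * G / V x s) * ennreal (cmod (k x y) * cmod (k y z) / (G * G / V x s))"
          proof (cases "G = 0")
            case True
            then show ?thesis using k_le[OF x y] by simp
          next
            case False
            then show ?thesis using G Vx by (simp flip: ennreal_mult)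
          qed
        qed
        also have "\<dots> = ennreal (G * G / V x s) * (\<integral>\<^sup>+y. ennreal (cmod (k x y) * cmod (k y z) / (G * G / V x s)) \<partial>\<mu>)"
          by (intro nn_integral_cmult) measurable
        also have "\<dots> \<le> ennreal (G * G / V x s) * ennreal (K * (1 + d z x / s) powr - M)"
        proof (intro mult_left_mono order_trans[OF _ K(2)[OF z]] nn_integral_mono ennreal_leI)
          fix y assume y: "y \<in> space \<mu>"
          have Vy: "V y s > 0" using V_pos y s by auto
          have "cmod (k x y) * cmod (k y z) \<le>
            G * ((1 + d y x / s) powr - M / V x s) * (G * ((1 + d z y / s) powr - M / V y s))"
            using G k_le x y z by (intro mult_mono) auto
          then show "cmod (k x y) * cmod (k y z) / (G * G / V x s)
            \<le> (1 + d y x / s) powr - M * ((1 + d z y / s) powr - M / V y s)"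
            using G Vx Vy by (cases "G = 0") (simp_all add: field_simps)
        qed auto
        also have "\<dots> = ennreal (G * G / V x s * K) * ennreal ((1 + d z x / s) powr - M)"
          using G Vx K by (simp add: mult.assoc flip: ennreal_mult)
        finally show ?thesis .
      qed
      finally show "(\<integral>\<^sup>+y. ennreal (cmod (k x y)) * (ennreal (cmod (k y z)) * ennreal (cmod (f z))) \<partial>\<mu>)
        \<le> ennreal (G * G / V x s * K) * (ennreal ((1 + d z x / s) powr - M) * ennreal (cmod (f z)))"
        by (simp add: mult.assoc mult_right_mono)
    qed
    also have "\<dots> = ennreal (G * G / V x s * K) * ?J" by (intro nn_integral_cmult) measurable
    also have "\<dots> < \<infinity>" using fin by (simp add: ennreal_mult_less_top)
    finally show ?thesis .
  qed
  have [measurable]: "(\<lambda>y. LINT z|\<mu>. k y z * f z) \<in> borel_measurable \<mu>"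
    by (rule integral_kernel_measurable) measurable
  show ?thesis
  proof (rule integrableI_bounded)
    have "(\<integral>\<^sup>+y. ennreal (norm (k x y * complex_of_real (cmod (f y - (LINT z|\<mu>. k y z * f z))))) \<partial>\<mu>)
      \<le> (\<integral>\<^sup>+y. ennreal (cmod (k x y)) * ennreal (cmod (f y))
          + (\<integral>\<^sup>+z. ennreal (cmod (k x y)) * (ennreal (cmod (k y z)) * ennreal (cmod (f z))) \<partial>\<mu>) \<partial>\<mu>)"
    proof (rule nn_integral_mono)
      fix y assume y: "y \<in> space \<mu>"
      have [measurable]: "(\<lambda>z. k y z) \<in> borel_measurable \<mu>"
        using measurable_compose[OF measurable_Pair1'[OF y] k] by simp
      \<comment> \<open>If the inner integral diverges, its value is 0 and the bound is
        trivial.\<close>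
      have "ennreal (cmod (LINT z|\<mu>. k y z * f z)) \<le> (\<integral>\<^sup>+z. ennreal (cmod (k y z * f z)) \<partial>\<mu>)"
        by (cases "integrable \<mu> (\<lambda>z. k y z * f z)")
          (auto intro: integral_norm_bound_ennreal simp: not_integrable_integral_eq)
      then have Ay: "ennreal (cmod (LINT z|\<mu>. k y z * f z)) \<le> (\<integral>\<^sup>+z. ennreal (cmod (k y z)) * ennreal (cmod (f z)) \<partial>\<mu>)"
        by (simp add: norm_mult ennreal_mult)
      have "ennreal (norm (k x y * complex_of_real (cmod (f y - (LINT z|\<mu>. k y z * f z)))))
        \<le> ennreal (cmod (k x y) * (cmod (f y) + cmod (LINT z|\<mu>. k y z * f z)))"
        by (intro ennreal_leI) (auto simp: norm_mult intro!: mult_left_mono norm_triangle_ineq4)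
      also have "\<dots> = ennreal (cmod (k x y)) * ennreal (cmod (f y))
          + ennreal (cmod (k x y)) * ennreal (cmod (LINT z|\<mu>. k y z * f z))"
        by (simp add: ennreal_mult distrib_left)
      also have "\<dots> \<le> ennreal (cmod (k x y)) * ennreal (cmod (f y))
          + ennreal (cmod (k x y)) * (\<integral>\<^sup>+z. ennreal (cmod (k y z)) * ennreal (cmod (f z)) \<partial>\<mu>)"
        by (intro add_left_mono mult_left_mono Ay) auto
      also have "\<dots> = ennreal (cmod (k x y)) * ennreal (cmod (f y))
          + (\<integral>\<^sup>+z. ennreal (cmod (k x y)) * (ennreal (cmod (k y z)) * ennreal (cmod (f z))) \<partial>\<mu>)"
        by (subst nn_integral_cmult) auto
      finally show "ennreal (norm (k x y * complex_of_real (cmod (f y - (LINT z|\<mu>. k y z * f z)))))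
        \<le> ennreal (cmod (k x y)) * ennreal (cmod (f y))
          + (\<integral>\<^sup>+z. ennreal (cmod (k x y)) * (ennreal (cmod (k y z)) * ennreal (cmod (f z))) \<partial>\<mu>)" .
    qed
    also have "\<dots> < \<infinity>" using I1 I2 by (subst nn_integral_add) auto
    finally show "(\<integral>\<^sup>+y. ennreal (norm (k x y * complex_of_real (cmod (f y - (LINT z|\<mu>. k y z * f z))))) \<partial>\<mu>) < \<infinity>" .
  qed measurable
qed

text \<open>The range of \<open>\<beta>\<close> is what makes this work: it leaves \<open>M\<close>
  larger than the exponent \<open>e\<close> of the weight in \<open>MX_at\<close> by more than
  \<open>deg_n\<close>. The excess pays for the growth of the volume in that weight, and changing
  the centre from \<open>x0\<close> to \<open>x\<close> and the scale from 1 to \<open>s\<close>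
  costs a constant factor.\<close>

lemma MX_integrable_decay:
  assumes f: "f \<in> MX \<mu> d \<phi> M" and M: "0 \<le> M" and x: "x \<in> space \<mu>" and s: "0 < s"
  shows "(\<integral>\<^sup>+z. ennreal ((1 + d z x / s) powr - M) * ennreal (cmod (f z)) \<partial>\<mu>) < \<infinity>"
proof -
  let ?q = "p_index \<mu> d \<phi> / i_index \<mu> \<phi>"
  obtain x0 \<beta> where x0: "x0 \<in> space \<mu>" and \<beta>: "\<beta> < M - deg_n \<mu> d * (1 + ?q) + deg_alpha \<mu> d"
    and fM: "f \<in> MX_at \<mu> d \<phi> x0 \<beta>"
    using f unfolding MX_def by auto
  define e where "e = weight_exponent \<mu> d \<phi> + \<beta>"
  have "deg_n \<mu> d < M - e" using \<beta> by (simp add: e_def weight_exponent_def algebra_simps)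
  then obtain n where n: "0 < n" "cond_D \<mu> d n" "n < M - e" using deg_n_less by blast
  obtain K where K: "K \<ge> 1"
    "\<And>x r l. x \<in> space \<mu> \<Longrightarrow> r > 0 \<Longrightarrow> l \<ge> 1 \<Longrightarrow> V x (l * r) \<le> K * l powr n * V x r"
    using cond_DE[OF n(2)] by blast
  note [measurable] = d_measurable[OF x0] d_measurable[OF x]
  have [measurable]: "f \<in> borel_measurable \<mu>" using fM by (auto simp: MX_at_def L1_loc_def)
  \<comment> \<open>Monotonicity in the radius is the source of the measurability of
    \<open>V x0 (\<rho> z)\<close> in \<open>z\<close>; for nonpositive radii the ball is
    empty.\<close>
  have "mono (\<lambda>r. V x0 r)"
  proof
    fix r r' :: real assume rr: "r \<le> r'"
    show "V x0 r \<le> V x0 r'"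
    proof (cases "r > 0")
      case True
      then show ?thesis using rr x0 by (intro V_mono ball_mono) auto
    next
      case False
      then have "B x0 r = {}" using d_nonneg x0 by (force simp: in_ball)
      then show ?thesis by simp
    qed
  qed
  then have Vm[measurable]: "(\<lambda>r. V x0 r) \<in> borel_measurable borel" by (rule borel_measurable_mono)
  define \<rho> where "\<rho> z = 1 + d z x0" for z
  have \<rho>m[measurable]: "\<rho> \<in> borel_measurable \<mu>" unfolding \<rho>_def by measurable
  define u where "u z = cmod (f z) / (\<rho> z powr e * V x0 (\<rho> z))" for z
  have [measurable]: "(\<lambda>z. V x0 (\<rho> z)) \<in> borel_measurable \<mu>"
    using measurable_compose[OF \<rho>m Vm] .
  have [measurable]: "u \<in> borel_measurable \<mu>" unfolding u_def by measurable
  have ufin: "(\<integral>\<^sup>+z. ennreal (u z) \<partial>\<mu>) < \<infinity>"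
  proof -
    have "(\<integral>\<^sup>+z. ennreal (u z) \<partial>\<mu>) = (\<integral>\<^sup>+z. ennreal (cmod (f z) /
        ((1 + d x0 z) powr (weight_exponent \<mu> d \<phi> + \<beta>) * V x0 (1 + d x0 z))) \<partial>\<mu>)"
      using x0 by (intro nn_integral_cong) (simp add: u_def \<rho>_def e_def d_sym)
    then show ?thesis using fM by (simp add: MX_at_def)
  qed
  \<comment> \<open>\<open>C\<close> dominates both the constant term and the coefficient of
    \<open>d z x / s\<close> in the bound for \<open>\<rho> z\<close>, so that
    \<open>\<rho> z \<le> C * W\<close>.\<close>
  define C where "C = 1 + \<kappa> * d x0 x + \<kappa> * s"
  have C: "C > 0" using d_nonneg[OF x0 x] \<kappa> s unfolding C_def by (simp add: add_pos_nonneg)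
  define A where "A = C powr M * (K * V x0 1)"
  have A: "A \<ge> 0" using K by (simp add: A_def)
  have "(\<integral>\<^sup>+z. ennreal ((1 + d z x / s) powr - M) * ennreal (cmod (f z)) \<partial>\<mu>)
    \<le> (\<integral>\<^sup>+z. ennreal A * ennreal (u z) \<partial>\<mu>)"
  proof (rule nn_integral_mono)
    fix z assume z: "z \<in> space \<mu>"
    define W where "W = 1 + d z x / s"
    have nn: "0 \<le> d z x" "0 \<le> d x0 x" "0 \<le> d z x0" using d_nonneg x0 x z by auto
    have W: "W \<ge> 1" using nn s by (simp add: W_def)
    have \<rho>1: "\<rho> z \<ge> 1" using nn by (simp add: \<rho>_def)
    have V\<rho>: "V x0 (\<rho> z) > 0" using V_pos x0 \<rho>1 by auto
    have "\<rho> z \<le> 1 + \<kappa> * (d z x + d x x0)" using d_triangle[OF z x0 x] by (simp add: \<rho>_def)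
    also have "\<dots> = (1 + \<kappa> * d x0 x) + \<kappa> * s * (d z x / s)"
      using s d_sym[OF x0 x] by (simp add: field_simps)
    also have "\<dots> \<le> C + C * (d z x / s)"
    proof (intro add_mono mult_right_mono)
      show "1 + \<kappa> * d x0 x \<le> C" "\<kappa> * s \<le> C"
        using \<kappa> s mult_nonneg_nonneg[of \<kappa> "d x0 x"] nn by (auto simp: C_def)
    qed (use s nn in auto)
    also have "\<dots> = C * W" by (simp add: W_def algebra_simps)
    finally have \<rho>W: "\<rho> z / C \<le> W" using C by (simp add: field_simps)
    have "W powr - M \<le> (\<rho> z / C) powr - M" using \<rho>W \<rho>1 C M by (intro powr_mono2') auto
    also have "\<dots> = C powr M * \<rho> z powr - M"
      using \<rho>1 C by (simp add: powr_divide powr_minus_divide)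
    also have "\<rho> z powr - M \<le> \<rho> z powr (- e - n)" using \<rho>1 n by (intro powr_mono) auto
    also have "\<rho> z powr (- e - n) \<le> K * V x0 1 / (\<rho> z powr e * V x0 (\<rho> z))"
    proof -
      have "V x0 (\<rho> z) \<le> K * \<rho> z powr n * V x0 1" using K(2)[OF x0 _ \<rho>1, of 1] by simp
      then show ?thesis using \<rho>1 V\<rho> by (simp add: powr_diff powr_minus field_simps)
    qed
    finally have "W powr - M \<le> C powr M * (K * V x0 1 / (\<rho> z powr e * V x0 (\<rho> z)))"
      by (simp add: mult_left_mono)
    then have "W powr - M * cmod (f z) \<le> C powr M * (K * V x0 1 / (\<rho> z powr e * V x0 (\<rho> z))) * cmod (f z)"
      by (intro mult_right_mono) auto
    also have "\<dots> = A * u z" by (simp add: A_def u_def)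
    finally show "ennreal ((1 + d z x / s) powr - M) * ennreal (cmod (f z)) \<le> ennreal A * ennreal (u z)"
      using A \<rho>1 by (simp add: W_def u_def ennreal_leI flip: ennreal_mult)
  qed
  also have "\<dots> = ennreal A * (\<integral>\<^sup>+z. ennreal (u z) \<partial>\<mu>)" by (intro nn_integral_cmult) measurable
  also have "\<dots> < \<infinity>" using ufin by (simp add: ennreal_mult_less_top)
  finally show ?thesis .
qed

end

section \<open>Growth functions and Muckenhoupt weights\<close>

text \<open>The weighted measure of \<open>E\<close> usually written
  \<open>\<phi>(E, t)\<close>.\<close>

definition wmass :: "'a measure \<Rightarrow> ('a \<Rightarrow> real \<Rightarrow> real) \<Rightarrow> 'a set \<Rightarrow> real \<Rightarrow> ennreal" where
  "wmass \<mu> \<phi> E t = (\<integral>\<^sup>+y\<in>E. ennreal (\<phi> y t) \<partial>\<mu>)"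

locale growth_space = homogeneous_space +
  fixes \<phi> :: "'a \<Rightarrow> real \<Rightarrow> real"
  assumes growth: "growth_function \<mu> d \<phi>"
begin

lemma phi_0: "x \<in> space \<mu> \<Longrightarrow> \<phi> x 0 = 0"
  using growth by (simp add: growth_function_def)

lemma phi_pos: "x \<in> space \<mu> \<Longrightarrow> 0 < t \<Longrightarrow> 0 < \<phi> x t"
  using growth by (simp add: growth_function_def)

lemma phi_nonneg: "x \<in> space \<mu> \<Longrightarrow> 0 \<le> t \<Longrightarrow> 0 \<le> \<phi> x t"
  using phi_pos[of x t] phi_0[of x] by (cases "t = 0") auto

lemma phi_measurable: "0 \<le> t \<Longrightarrow> (\<lambda>x. \<phi> x t) \<in> borel_measurable \<mu>"
  using growth by (simp add: growth_function_def)

lemma wmass_mono: "E \<subseteq> E' \<Longrightarrow> wmass \<mu> \<phi> E t \<le> wmass \<mu> \<phi> E' t"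
  unfolding wmass_def by (intro nn_integral_mono) (auto simp: indicator_def)

text \<open>A strictly positive function on a set of positive measure. Positivity excludes products
  of 0 and infinity when finiteness is read off from the Muckenhoupt condition.\<close>

lemma wmass_pos:
  assumes "x \<in> space \<mu>" "0 < r" "0 < t"
  shows "0 < wmass \<mu> \<phi> (B x r) t"
proof -
  note [measurable] = phi_measurable[OF less_imp_le[OF assms(3)]] ball_sets[OF assms(1,2)]
  have "wmass \<mu> \<phi> (B x r) t \<noteq> 0"
  proof
    assume "wmass \<mu> \<phi> (B x r) t = 0"
    then have "AE y in \<mu>. ennreal (\<phi> y t) * indicator (B x r) y = 0"
      unfolding wmass_def by (subst (asm) nn_integral_0_iff_AE) auto
    then have "AE y in \<mu>. y \<notin> B x r"
    proof (rule AE_mp, intro AE_I2 impI)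
      fix y assume "y \<in> space \<mu>" "ennreal (\<phi> y t) * indicator (B x r) y = 0"
      then show "y \<notin> B x r" using phi_pos[of y t] assms by (auto simp: indicator_def split: if_splits)
    qed
    then have "emeasure \<mu> (B x r) = 0"
      using AE_iff_null_sets[OF ball_sets[OF assms(1,2)]] by auto
    then show False using ball_pos[OF assms(1,2)] by simp
  qed
  then show ?thesis by (simp add: zero_less_iff_neq_zero)
qed

text \<open>The essential supremum \<open>S\<close> dominates \<open>inverse (\<phi> z t)\<close>
  almost everywhere on the large ball, so the volume of a smaller ball is at most \<open>S\<close>
  times its mass. The Muckenhoupt condition bounds the product of \<open>S\<close> and the large
  mass, and eliminating \<open>S\<close> gives the claim.\<close>

lemma Ap_1_mass:
  assumes K: "\<And>t x r. 0 < t \<Longrightarrow> x \<in> space \<mu> \<Longrightarrow> 0 < r \<Longrightarrow>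
      avg \<mu> (B x r) (\<lambda>x. \<phi> x t) * ess_sup_on \<mu> (B x r) (\<lambda>y. inverse (\<phi> y t)) \<le> ennreal K"
    and t: "0 < t" and x: "x \<in> space \<mu>" "0 < r" and y: "y \<in> space \<mu>" "0 < s" and sub: "B y s \<subseteq> B x r"
  shows "wmass \<mu> \<phi> (B x r) t * ennreal (V y s) \<le> ennreal (K * V x r) * wmass \<mu> \<phi> (B y s) t"
    and "wmass \<mu> \<phi> (B x r) t < \<infinity>"
proof -
  note [measurable] = phi_measurable[OF less_imp_le[OF t]] ball_sets[OF x] ball_sets[OF y]
  define S where "S = ess_sup_on \<mu> (B x r) (\<lambda>y. inverse (\<phi> y t))"
  have V: "V x r > 0" "V y s > 0" using V_pos x y by auto
  have "AE y in restrict_space \<mu> (B x r). ennreal (inverse (\<phi> y t)) \<le> S"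
    unfolding S_def ess_sup_on_def by (rule esssup_AE)
  then have AE: "AE y in \<mu>. y \<in> B x r \<longrightarrow> ennreal (inverse (\<phi> y t)) \<le> S"
    by (subst (asm) AE_restrict_space_iff) auto
  have one: "AE z in \<mu>. (indicator E z :: ennreal) \<le> S * (ennreal (\<phi> z t) * indicator E z)"
    if "E \<subseteq> B x r" for E
  proof (rule AE_mp[OF AE], intro AE_I2 impI)
    fix z assume z: "z \<in> space \<mu>" "z \<in> B x r \<longrightarrow> ennreal (inverse (\<phi> z t)) \<le> S"
    show "(indicator E z :: ennreal) \<le> S * (ennreal (\<phi> z t) * indicator E z)"
    proof (cases "z \<in> E")
      case True
      have "1 = ennreal (inverse (\<phi> z t)) * ennreal (\<phi> z t)"
        using phi_pos[OF z(1) t] by (simp flip: ennreal_mult)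
      also have "\<dots> \<le> S * ennreal (\<phi> z t)" using z True that by (intro mult_right_mono) auto
      finally show ?thesis using True by simp
    qed simp
  qed
  have mass: "ennreal (V u e) \<le> S * wmass \<mu> \<phi> (B u e) t"
    if u: "u \<in> space \<mu>" "0 < e" "B u e \<subseteq> B x r" for u e
  proof -
    note [measurable] = ball_sets[OF u(1,2)]
    have "ennreal (V u e) = (\<integral>\<^sup>+z. indicator (B u e) z \<partial>\<mu>)" using u by (simp add: emeasure_ball)
    also have "\<dots> \<le> (\<integral>\<^sup>+z. S * (ennreal (\<phi> z t) * indicator (B u e) z) \<partial>\<mu>)"
      by (intro nn_integral_mono_AE one u)
    also have "\<dots> = S * wmass \<mu> \<phi> (B u e) t" unfolding wmass_def by (intro nn_integral_cmult) measurable
    finally show ?thesis .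
  qed
  have avg: "wmass \<mu> \<phi> (B x r) t * S \<le> ennreal (K * V x r)"
  proof -
    have "avg \<mu> (B x r) (\<lambda>x. \<phi> x t) * S \<le> ennreal K" unfolding S_def by (rule K[OF t x])
    then have "(wmass \<mu> \<phi> (B x r) t / ennreal (V x r) * S) * ennreal (V x r) \<le> ennreal K * ennreal (V x r)"
      using x by (intro mult_right_mono) (auto simp: avg_def wmass_def emeasure_ball)
    also have "(wmass \<mu> \<phi> (B x r) t / ennreal (V x r) * S) * ennreal (V x r)
        = wmass \<mu> \<phi> (B x r) t * S * (ennreal (V x r) / ennreal (V x r))"
      by (simp add: divide_ennreal_def mult_ac)
    finally show ?thesis using V by (simp add: ennreal_mult'' divide_ennreal)
  qed
  show "wmass \<mu> \<phi> (B x r) t * ennreal (V y s) \<le> ennreal (K * V x r) * wmass \<mu> \<phi> (B y s) t"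
  proof -
    have "wmass \<mu> \<phi> (B x r) t * ennreal (V y s) \<le> wmass \<mu> \<phi> (B x r) t * (S * wmass \<mu> \<phi> (B y s) t)"
      by (intro mult_left_mono mass y sub) auto
    also have "\<dots> \<le> ennreal (K * V x r) * wmass \<mu> \<phi> (B y s) t"
      unfolding mult.assoc[symmetric] by (intro mult_right_mono avg) auto
    finally show ?thesis .
  qed
  \<comment> \<open>As \<open>S\<close> is not 0, an infinite mass would make its product with
    \<open>S\<close> infinite.\<close>
  have "S \<noteq> 0" using mass[OF x order_refl] V by auto
  then show "wmass \<mu> \<phi> (B x r) t < \<infinity>"
    using avg by (metis ennreal_less_top ennreal_top_mult infinity_ennreal_def leD less_top mult_zero_left top_neq_ennreal ennreal_mult_eq_top_iff order_le_less_trans)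
qed

text \<open>Hoelder's inequality is replaced by the pointwise bound \<open>1 \<le> u + u powr (- 1 / (p - 1))\<close>
  for \<open>u > 0\<close>, applied to \<open>u = \<phi> z t / b\<close> with a suitable \<open>b\<close>.\<close>

lemma Ap_gt_1_mass:
  assumes p: "1 < p" and K0: "0 \<le> K"
    and K: "\<And>t x r. 0 < t \<Longrightarrow> x \<in> space \<mu> \<Longrightarrow> 0 < r \<Longrightarrow>
      avg \<mu> (B x r) (\<lambda>x. \<phi> x t) *
      ennpowr (avg \<mu> (B x r) (\<lambda>x. \<phi> x t powr (- 1 / (p - 1)))) (p - 1) \<le> ennreal K"
    and t: "0 < t" and x: "x \<in> space \<mu>" "0 < r" and y: "y \<in> space \<mu>" "0 < s" and sub: "B y s \<subseteq> B x r"
  shows "wmass \<mu> \<phi> (B x r) t \<le> ennreal (K * (2 * V x r / V y s) powr p) * wmass \<mu> \<phi> (B y s) t"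
    and "wmass \<mu> \<phi> (B x r) t < \<infinity>"
proof -
  note [measurable] = phi_measurable[OF less_imp_le[OF t]] ball_sets[OF x] ball_sets[OF y]
  have V: "V x r > 0" "V y s > 0" using V_pos x y by auto
  define \<psi> where "\<psi> z = \<phi> z t powr (- 1 / (p - 1))" for z
  have [measurable]: "\<psi> \<in> borel_measurable \<mu>" unfolding \<psi>_def by measurable
  define Q where "Q = avg \<mu> (B x r) \<psi>"
  let ?W = "wmass \<mu> \<phi> (B x r) t"
  have AQ: "?W / ennreal (V x r) * ennpowr Q (p - 1) \<le> ennreal K"
    using K[OF t x] x by (simp add: Q_def \<psi>_def[abs_def] avg_def wmass_def emeasure_ball)
  have Wpos: "0 < ?W" "0 < wmass \<mu> \<phi> (B y s) t" using wmass_pos x y t by auto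
  have "(\<integral>\<^sup>+z\<in>B x r. ennreal (\<psi> z) \<partial>\<mu>) \<noteq> 0"
  proof
    assume "(\<integral>\<^sup>+z\<in>B x r. ennreal (\<psi> z) \<partial>\<mu>) = 0"
    then have "AE z in \<mu>. ennreal (\<psi> z) * indicator (B x r) z = 0"
      by (subst (asm) nn_integral_0_iff_AE) auto
    then have "AE z in \<mu>. ennreal (\<phi> z t) * indicator (B x r) z = 0"
    proof (rule AE_mp, intro AE_I2 impI)
      fix z assume "z \<in> space \<mu>" "ennreal (\<psi> z) * indicator (B x r) z = 0"
      then show "ennreal (\<phi> z t) * indicator (B x r) z = 0"
        using phi_pos[of z t] t by (auto simp: indicator_def \<psi>_def split: if_splits)
    qed
    then have "?W = 0" unfolding wmass_def by (subst nn_integral_0_iff_AE) auto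
    then show False using Wpos by simp
  qed
  then have Q0: "Q \<noteq> 0" using x by (simp add: Q_def avg_def emeasure_ball)
  have Qtop: "Q \<noteq> \<infinity>"
  proof
    assume Q: "Q = \<infinity>"
    have "?W / ennreal (V x r) \<noteq> 0" using Wpos by simp
    then have "?W / ennreal (V x r) * ennpowr Q (p - 1) = \<infinity>"
      using Q by (simp add: ennpowr_def ennreal_mult_eq_top_iff)
    then show False using AQ by (simp add: top_unique)
  qed
  then obtain q where q: "Q = ennreal q" "q > 0"
    using Q0 by (cases Q) (auto simp: less_le)
  have W1: "?W * ennreal (q powr (p - 1)) \<le> ennreal (K * V x r)"
  proof -
    have "(?W / ennreal (V x r) * ennreal (q powr (p - 1))) * ennreal (V x r) \<le> ennreal K * ennreal (V x r)"
      using AQ q by (intro mult_right_mono) (auto simp: ennpowr_def)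
    also have "(?W / ennreal (V x r) * ennreal (q powr (p - 1))) * ennreal (V x r)
        = ?W * ennreal (q powr (p - 1)) * (ennreal (V x r) / ennreal (V x r))"
      by (simp add: divide_ennreal_def mult_ac)
    finally show ?thesis using V by (simp add: ennreal_mult'' divide_ennreal)
  qed
  have Wfin: "?W \<noteq> \<infinity>"
  proof
    assume "?W = \<infinity>"
    then have "?W * ennreal (q powr (p - 1)) = \<infinity>" using q by (simp add: ennreal_mult_eq_top_iff)
    then show False using W1 by (simp add: top_unique)
  qed
  then show "?W < \<infinity>" by (simp add: less_top)
  \<comment> \<open>With this \<open>b\<close> the second term of the pointwise bound integrates to
    exactly half of \<open>V y s\<close>, which is absorbed on the left; this is the origin of the
    factor 2 in the claim.\<close>
  define b where "b = (V y s / (2 * (q * V x r))) powr (p - 1)"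
  have b: "b > 0" using V q by (simp add: b_def)
  have b1: "b powr (1 / (p - 1)) * (q * V x r) = V y s / 2"
    using V q p by (simp add: b_def powr_powr)
  have \<Psi>: "(\<integral>\<^sup>+z\<in>B x r. ennreal (\<psi> z) \<partial>\<mu>) = ennreal (q * V x r)"
  proof -
    have "(\<integral>\<^sup>+z\<in>B x r. ennreal (\<psi> z) \<partial>\<mu>) = (\<integral>\<^sup>+z\<in>B x r. ennreal (\<psi> z) \<partial>\<mu>) / ennreal (V x r) * ennreal (V x r)"
      using V by (simp add: divide_ennreal_def mult.assoc inverse_ennreal flip: ennreal_mult)
    also have "\<dots> = ennreal q * ennreal (V x r)"
      using q x by (simp add: Q_def avg_def emeasure_ball)
    finally show ?thesis using q by (simp add: ennreal_mult)
  qed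
  have pw: "1 \<le> \<phi> z t / b + b powr (1 / (p - 1)) * \<psi> z" if z: "z \<in> space \<mu>" for z
  proof (cases "b \<le> \<phi> z t")
    case True
    then show ?thesis using b by (simp add: \<psi>_def add_increasing2)
  next
    case False
    have "b powr (1 / (p - 1)) * \<psi> z = (b / \<phi> z t) powr (1 / (p - 1))"
      using b phi_pos[OF z t] by (simp add: \<psi>_def powr_divide powr_minus_divide)
    also have "\<dots> \<ge> 1" using False b phi_pos[OF z t] p by (intro ge_one_powr_ge_zero) auto
    finally show ?thesis using b phi_pos[OF z t] by (simp add: add_increasing)
  qed
  obtain w where w: "wmass \<mu> \<phi> (B y s) t = ennreal w" "w > 0"
    using Wpos(2) wmass_mono[OF sub, of t] Wfin
    by (cases "wmass \<mu> \<phi> (B y s) t") (auto simp: top_unique)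
  have "ennreal (V y s) = (\<integral>\<^sup>+z. indicator (B y s) z \<partial>\<mu>)" using y by (simp add: emeasure_ball)
  also have "\<dots> \<le> (\<integral>\<^sup>+z. ennreal (1 / b) * (ennreal (\<phi> z t) * indicator (B y s) z)
      + ennreal (b powr (1 / (p - 1))) * (ennreal (\<psi> z) * indicator (B x r) z) \<partial>\<mu>)"
  proof (rule nn_integral_mono)
    fix z assume z: "z \<in> space \<mu>"
    have "ennreal 1 \<le> ennreal (\<phi> z t / b + b powr (1 / (p - 1)) * \<psi> z)" using pw[OF z] by (rule ennreal_leI)
    also have "\<dots> = ennreal (1 / b) * ennreal (\<phi> z t) + ennreal (b powr (1 / (p - 1))) * ennreal (\<psi> z)"
      using b phi_pos[OF z t] by (simp add: \<psi>_def flip: ennreal_mult ennreal_plus)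
    finally show "(indicator (B y s) z :: ennreal) \<le> ennreal (1 / b) * (ennreal (\<phi> z t) * indicator (B y s) z)
      + ennreal (b powr (1 / (p - 1))) * (ennreal (\<psi> z) * indicator (B x r) z)"
      using sub by (auto simp: indicator_def)
  qed
  also have "\<dots> = ennreal (1 / b) * wmass \<mu> \<phi> (B y s) t
      + ennreal (b powr (1 / (p - 1))) * (\<integral>\<^sup>+z\<in>B x r. ennreal (\<psi> z) \<partial>\<mu>)"
    unfolding wmass_def by (simp add: nn_integral_add nn_integral_cmult)
  also have "\<dots> = ennreal (w / b + V y s / 2)"
    unfolding w \<Psi> using b w q V b1 by (simp flip: ennreal_mult ennreal_plus)
  finally have "V y s \<le> w / b + V y s / 2" using b w V by (subst (asm) ennreal_le_iff) auto
  then have bw: "b * V y s \<le> 2 * w" using b by (simp add: field_simps)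
  obtain W where W: "?W = ennreal W" "W \<ge> 0" using Wfin by (cases ?W) auto
  have "W * q powr (p - 1) \<le> K * V x r"
    using W1 W K0 V by (simp flip: ennreal_mult)
  then have "W \<le> K * V x r / q powr (p - 1)" using q by (simp add: field_simps)
  \<comment> \<open>Solving the definition of \<open>b\<close> for \<open>q\<close> removes the
    unknown average.\<close>
  also have "\<dots> = K * V x r * (2 * V x r / V y s) powr (p - 1) * b"
    using V q by (simp add: b_def powr_divide powr_mult)
  also have "\<dots> \<le> K * V x r * (2 * V x r / V y s) powr (p - 1) * (2 * w / V y s)"
    using bw V K0 by (intro mult_left_mono) (auto simp: field_simps)
  also have "\<dots> = K * (2 * V x r / V y s) powr p * w"
    using V by (simp add: powr_diff)
  finally show "?W \<le> ennreal (K * (2 * V x r / V y s) powr p) * wmass \<mu> \<phi> (B y s) t"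
    unfolding W w using K0 w by (simp flip: ennreal_mult)
qed

text \<open>Brings \<open>p = 1\<close> and \<open>p > 1\<close> to one form, uniform in
  \<open>t\<close>: the mass ratio of nested balls is controlled by the \<open>p\<close>-th power of
  their volume ratio. Local integrability of \<open>\<phi>\<close> comes out of the Muckenhoupt
  condition as well.\<close>

lemma Ap_mass:
  assumes p: "1 \<le> p" and Ap: "Ap \<mu> d p \<phi>"
  obtains K where "K \<ge> 1"
    "\<And>t x r. 0 < t \<Longrightarrow> x \<in> space \<mu> \<Longrightarrow> 0 < r \<Longrightarrow> wmass \<mu> \<phi> (B x r) t < \<infinity>"
    "\<And>t x r y s. 0 < t \<Longrightarrow> x \<in> space \<mu> \<Longrightarrow> 0 < r \<Longrightarrow> y \<in> space \<mu> \<Longrightarrow> 0 < s \<Longrightarrow> B y s \<subseteq> B x r \<Longrightarrow>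
      wmass \<mu> \<phi> (B x r) t \<le> ennreal (K * (2 * V x r / V y s) powr p) * wmass \<mu> \<phi> (B y s) t"
proof -
  define X where "X t E = avg \<mu> E (\<lambda>x. \<phi> x t) *
        (if p = 1 then ess_sup_on \<mu> E (\<lambda>y. inverse (\<phi> y t))
         else ennpowr (avg \<mu> E (\<lambda>x. \<phi> x t powr (- 1 / (p - 1)))) (p - 1))" for t E
  have "(SUP t \<in> {0<..}. SUP E \<in> balls \<mu> d. X t E) < \<infinity>"
    using Ap unfolding Ap_def X_def .
  then obtain K0 where K0: "K0 \<ge> 0" "(SUP t \<in> {0<..}. SUP E \<in> balls \<mu> d. X t E) = ennreal K0"
    by (cases "SUP t \<in> {0<..}. SUP E \<in> balls \<mu> d. X t E") auto
  define K where "K = max 1 K0"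
  have K: "X t (B x r) \<le> ennreal K" if "0 < t" "x \<in> space \<mu>" "0 < r" for t x r
  proof -
    have "B x r \<in> balls \<mu> d" using that by (auto simp: balls_def)
    then have "X t (B x r) \<le> (SUP E \<in> balls \<mu> d. X t E)" by (rule SUP_upper)
    also have "\<dots> \<le> (SUP t \<in> {0<..}. SUP E \<in> balls \<mu> d. X t E)" using that by (intro SUP_upper) auto
    also have "\<dots> \<le> ennreal K" unfolding K0 K_def by (intro ennreal_leI) auto
    finally show ?thesis .
  qed
  show ?thesis
  proof (cases "p = 1")
    case True
    then have K1: "\<And>t x r. 0 < t \<Longrightarrow> x \<in> space \<mu> \<Longrightarrow> 0 < r \<Longrightarrow>
      avg \<mu> (B x r) (\<lambda>x. \<phi> x t) * ess_sup_on \<mu> (B x r) (\<lambda>y. inverse (\<phi> y t)) \<le> ennreal K"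
      using K by (simp add: X_def)
    show ?thesis
    proof (rule that[of K])
      show "K \<ge> 1" by (simp add: K_def)
      show "wmass \<mu> \<phi> (B x r) t < \<infinity>" if "0 < t" "x \<in> space \<mu>" "0 < r" for t x r
        by (rule Ap_1_mass(2)[OF K1 that that(2,3) order_refl])
    next
      fix t r s :: real and x y
      assume h: "0 < t" "x \<in> space \<mu>" "0 < r" "y \<in> space \<mu>" "0 < s" "B y s \<subseteq> B x r"
      have V: "V x r > 0" "V y s > 0" using V_pos h by auto
      have "wmass \<mu> \<phi> (B x r) t = wmass \<mu> \<phi> (B x r) t * ennreal (V y s) * ennreal (1 / V y s)"
        using V by (simp add: mult.assoc flip: ennreal_mult)
      also have "\<dots> \<le> ennreal (K * V x r) * wmass \<mu> \<phi> (B y s) t * ennreal (1 / V y s)"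
        by (intro mult_right_mono Ap_1_mass(1)[OF K1 h]) auto
      also have "\<dots> = ennreal (K * V x r) * ennreal (1 / V y s) * wmass \<mu> \<phi> (B y s) t"
        by (simp add: mult_ac)
      also have "\<dots> = ennreal (K * (V x r / V y s)) * wmass \<mu> \<phi> (B y s) t"
        using V by (simp add: K_def flip: ennreal_mult)
      also have "\<dots> \<le> ennreal (K * (2 * V x r / V y s) powr p) * wmass \<mu> \<phi> (B y s) t"
        using V True by (intro mult_right_mono ennreal_leI mult_left_mono) (auto simp: K_def field_simps)
      finally show "wmass \<mu> \<phi> (B x r) t \<le> ennreal (K * (2 * V x r / V y s) powr p) * wmass \<mu> \<phi> (B y s) t" .
    qed
  next
    case False
    then have p1: "1 < p" using p by simp
    have K1: "\<And>t x r. 0 < t \<Longrightarrow> x \<in> space \<mu> \<Longrightarrow> 0 < r \<Longrightarrow>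
      avg \<mu> (B x r) (\<lambda>x. \<phi> x t) *
      ennpowr (avg \<mu> (B x r) (\<lambda>x. \<phi> x t powr (- 1 / (p - 1)))) (p - 1) \<le> ennreal K"
      using K False by (simp add: X_def)
    have K': "0 \<le> K" by (simp add: K_def)
    show ?thesis
    proof (rule that[of K])
      show "K \<ge> 1" by (simp add: K_def)
      show "wmass \<mu> \<phi> (B x r) t < \<infinity>" if "0 < t" "x \<in> space \<mu>" "0 < r" for t x r
        by (rule Ap_gt_1_mass(2)[OF p1 K' K1 that that(2,3) order_refl])
      show "wmass \<mu> \<phi> (B x r) t \<le> ennreal (K * (2 * V x r / V y s) powr p) * wmass \<mu> \<phi> (B y s) t"
        if "0 < t" "x \<in> space \<mu>" "0 < r" "y \<in> space \<mu>" "0 < s" "B y s \<subseteq> B x r" for t x r y s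
        by (rule Ap_gt_1_mass(1)[OF p1 K' K1 that])
    qed
  qed
qed

section \<open>Orlicz norms of indicators of balls\<close>

lemma Lphi_norm_indicator:
  assumes "E \<in> sets \<mu>"
  shows "Lphi_norm \<mu> \<phi> (indicator E) = Inf {ennreal l | l. 0 < l \<and> wmass \<mu> \<phi> E (1 / l) \<le> 1}"
proof -
  have "(\<integral>\<^sup>+x. ennreal (\<phi> x (\<bar>indicator E x\<bar> / l)) \<partial>\<mu>) = wmass \<mu> \<phi> E (1 / l)" for l
    unfolding wmass_def by (intro nn_integral_cong) (auto simp: indicator_def phi_0)
  then show ?thesis by (simp add: Lphi_norm_def)
qed

lemma Lphi_norm_le:
  assumes "E \<in> sets \<mu>" "0 < l" "wmass \<mu> \<phi> E (1 / l) \<le> 1"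
  shows "Lphi_norm \<mu> \<phi> (indicator E) \<le> ennreal l"
  unfolding Lphi_norm_indicator[OF assms(1)] using assms by (intro Inf_lower) auto

text \<open>The infimum defining the norm need not be attained, so a lower bound is tested on every
  admissible \<open>l\<close>.\<close>

lemma Lphi_norm_ge:
  assumes E: "E \<in> sets \<mu>" and K: "0 < K"
    and le: "\<And>l. 0 < l \<Longrightarrow> wmass \<mu> \<phi> E (1 / l) \<le> 1 \<Longrightarrow> D \<le> ennreal K * ennreal l"
  shows "D \<le> ennreal K * Lphi_norm \<mu> \<phi> (indicator E)"
proof -
  have "ennreal (1 / K) * D \<le> Lphi_norm \<mu> \<phi> (indicator E)"
    unfolding Lphi_norm_indicator[OF E]
  proof (rule Inf_greatest)
    fix u assume "u \<in> {ennreal l | l. 0 < l \<and> wmass \<mu> \<phi> E (1 / l) \<le> 1}"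
    then obtain l where l: "u = ennreal l" "0 < l" "wmass \<mu> \<phi> E (1 / l) \<le> 1" by auto
    have "ennreal (1 / K) * D \<le> ennreal (1 / K) * (ennreal K * ennreal l)"
      by (intro mult_left_mono le l) auto
    also have "\<dots> = ennreal l" using K l by (simp flip: ennreal_mult)
    finally show "ennreal (1 / K) * D \<le> u" using l by simp
  qed
  then have "ennreal K * (ennreal (1 / K) * D) \<le> ennreal K * Lphi_norm \<mu> \<phi> (indicator E)"
    by (intro mult_left_mono) auto
  then show ?thesis using K by (simp add: mult.assoc[symmetric] flip: ennreal_mult)
qed

text \<open>By lower type \<open>i\<close>, enlarging \<open>l\<close> by the factor
  \<open>(K * A) powr (1 / i)\<close> divides \<open>\<phi>\<close> by at least \<open>A\<close>,
  which brings a mass of at most \<open>A\<close> down to at most 1.\<close>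

lemma Lphi_norm_le_mass:
  assumes i: "0 < i" "lower_type \<mu> i \<phi>"
  obtains K where "K \<ge> 1"
    "\<And>E l A. E \<in> sets \<mu> \<Longrightarrow> 0 < l \<Longrightarrow> 1 \<le> A \<Longrightarrow> wmass \<mu> \<phi> E (1 / l) \<le> ennreal A \<Longrightarrow>
      Lphi_norm \<mu> \<phi> (indicator E) \<le> ennreal (l * (K * A) powr (1 / i))"
proof -
  obtain C where C: "\<And>x t s. x \<in> space \<mu> \<Longrightarrow> 0 \<le> t \<Longrightarrow> 0 < s \<Longrightarrow> s < 1 \<Longrightarrow>
      \<phi> x (s * t) \<le> C * s powr i * \<phi> x t"
    using i(2) unfolding lower_type_def by fastforce
  \<comment> \<open>The 2 makes \<open>K * A\<close>, and hence \<open>b\<close>, larger than 1, so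
    that \<open>1 / b\<close> lies in the open interval in which lower type may be applied.\<close>
  define K where "K = max C 2"
  show ?thesis
  proof (rule that[of K])
    show "K \<ge> 1" by (simp add: K_def)
    fix E l A assume E: "E \<in> sets \<mu>" and l: "0 < l" and A: "1 \<le> (A::real)"
      and mass: "wmass \<mu> \<phi> E (1 / l) \<le> ennreal A"
    define b where "b = (K * A) powr (1 / i)"
    have K2: "2 \<le> K" by (simp add: K_def)
    then have KA: "K * A > 1" using A mult_mono[of 2 K 1 A] by simp
    have b: "b > 1" unfolding b_def using KA i by (intro gr_one_powr) auto
    have bi: "b powr i = K * A" using KA i by (simp add: b_def powr_powr)
    note [measurable] = phi_measurable[of "1 / l"] E
    have "wmass \<mu> \<phi> E (1 / (l * b)) \<le> (\<integral>\<^sup>+y. ennreal (1 / A) * (ennreal (\<phi> y (1 / l)) * indicator E y) \<partial>\<mu>)"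
      unfolding wmass_def
    proof (rule nn_integral_mono)
      fix y assume y: "y \<in> space \<mu>"
      have "\<phi> y (1 / (l * b)) = \<phi> y ((1 / b) * (1 / l))" by (simp add: mult.commute)
      also have "\<dots> \<le> C * (1 / b) powr i * \<phi> y (1 / l)" using y l b by (intro C) auto
      also have "\<dots> \<le> K * (1 / b) powr i * \<phi> y (1 / l)"
        using phi_nonneg[OF y, of "1 / l"] l by (intro mult_right_mono) (auto simp: K_def)
      also have "\<dots> = (1 / A) * \<phi> y (1 / l)" using b bi K2 A by (simp add: powr_divide field_simps)
      finally have "ennreal (\<phi> y (1 / (l * b))) \<le> ennreal (1 / A) * ennreal (\<phi> y (1 / l))"
        using A phi_nonneg[OF y, of "1 / l"] l by (simp add: ennreal_leI flip: ennreal_mult)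
      then show "ennreal (\<phi> y (1 / (l * b))) * indicator E y
          \<le> ennreal (1 / A) * (ennreal (\<phi> y (1 / l)) * indicator E y)"
        unfolding mult.assoc[symmetric] by (intro mult_right_mono) auto
    qed
    also have "\<dots> = ennreal (1 / A) * wmass \<mu> \<phi> E (1 / l)"
      unfolding wmass_def using l by (intro nn_integral_cmult) auto
    also have "\<dots> \<le> ennreal (1 / A) * ennreal A" using mass by (intro mult_left_mono) auto
    also have "\<dots> = 1" using A by (simp flip: ennreal_mult)
    finally show "Lphi_norm \<mu> \<phi> (indicator E) \<le> ennreal (l * (K * A) powr (1 / i))"
      using E l b unfolding b_def[symmetric] by (intro Lphi_norm_le) auto
  qed
qed

abbreviation L where "L x r \<equiv> Lphi_norm \<mu> \<phi> (indicator (B x r))"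

text \<open>Division by an infinite norm would give 0, and the BMO condition on the ball would carry
  no information.\<close>

lemma L_finite:
  assumes i: "0 < i" "lower_type \<mu> i \<phi>" and p: "1 \<le> p" "Ap \<mu> d p \<phi>"
    and x: "x \<in> space \<mu>" "0 < r"
  shows "L x r < \<infinity>"
proof -
  obtain K where K: "K \<ge> 1" "\<And>E l A. E \<in> sets \<mu> \<Longrightarrow> 0 < l \<Longrightarrow> 1 \<le> A \<Longrightarrow> wmass \<mu> \<phi> E (1 / l) \<le> ennreal A \<Longrightarrow>
      Lphi_norm \<mu> \<phi> (indicator E) \<le> ennreal (l * (K * A) powr (1 / i))"
    using Lphi_norm_le_mass[OF i] by blast
  have "wmass \<mu> \<phi> (B x r) 1 < \<infinity>" using Ap_mass[OF p] x zero_less_one by metis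
  then obtain w where w: "wmass \<mu> \<phi> (B x r) 1 = ennreal w" by (cases "wmass \<mu> \<phi> (B x r) 1") auto
  have "L x r \<le> ennreal (1 * (K * max 1 w) powr (1 / i))"
    using x w by (intro K ball_sets) (auto intro: ennreal_leI)
  then show ?thesis by (rule order.strict_trans1) simp
qed

text \<open>By (A_p) and (D_n), dilation by \<open>l\<close> multiplies the mass by at most a
  constant times \<open>l powr (n * p)\<close>; lower type then turns this into its
  \<open>i\<close>-th root for the norm.\<close>

lemma L_dilate:
  assumes i: "0 < i" "lower_type \<mu> i \<phi>" and p: "1 \<le> p" "Ap \<mu> d p \<phi>" and n: "0 < n" "cond_D \<mu> d n"
  shows "\<exists>K>0. \<forall>x\<in>space \<mu>. \<forall>r>0. \<forall>l\<ge>1. L x (l * r) \<le> ennreal (K * l powr (n * p / i)) * L x r"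
proof -
  obtain K1 where K1: "K1 \<ge> 1" "\<And>E l A. E \<in> sets \<mu> \<Longrightarrow> 0 < l \<Longrightarrow> 1 \<le> A \<Longrightarrow> wmass \<mu> \<phi> E (1 / l) \<le> ennreal A \<Longrightarrow>
      Lphi_norm \<mu> \<phi> (indicator E) \<le> ennreal (l * (K1 * A) powr (1 / i))"
    using Lphi_norm_le_mass[OF i] by blast
  obtain K2 where K2: "K2 \<ge> 1"
    "\<And>t x r y s. 0 < t \<Longrightarrow> x \<in> space \<mu> \<Longrightarrow> 0 < r \<Longrightarrow> y \<in> space \<mu> \<Longrightarrow> 0 < s \<Longrightarrow> B y s \<subseteq> B x r \<Longrightarrow>
      wmass \<mu> \<phi> (B x r) t \<le> ennreal (K2 * (2 * V x r / V y s) powr p) * wmass \<mu> \<phi> (B y s) t"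
    using Ap_mass[OF p] by metis
  obtain K3 where K3: "K3 \<ge> 1"
    "\<And>x r l. x \<in> space \<mu> \<Longrightarrow> r > 0 \<Longrightarrow> l \<ge> 1 \<Longrightarrow> V x (l * r) \<le> K3 * l powr n * V x r"
    using cond_DE[OF n(2)] by blast
  define K where "K = (K1 * K2 * (2 * K3) powr p) powr (1 / i)"
  have Kpos: "K > 0" using K1 K2 K3 by (simp add: K_def)
  have "L x (l * r) \<le> ennreal (K * l powr (n * p / i)) * L x r"
    if h: "x \<in> space \<mu>" "r > 0" "l \<ge> 1" for x r l
  proof (rule Lphi_norm_ge)
    show "B x r \<in> sets \<mu>" using h ball_sets by auto
    show "0 < K * l powr (n * p / i)" using Kpos h by simp
    fix u assume u: "0 < u" "wmass \<mu> \<phi> (B x r) (1 / u) \<le> 1"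
    define A where "A = K2 * (2 * K3 * l powr n) powr p"
    have V: "V x r > 0" using V_pos h by auto
    have l1: "1 \<le> l powr n" using h n by (intro ge_one_powr_ge_zero) auto
    then have "1 \<le> 2 * K3 * l powr n" using K3 mult_mono[of 1 "2 * K3" 1 "l powr n"] by simp
    then have "1 \<le> (2 * K3 * l powr n) powr p" using p by (intro ge_one_powr_ge_zero) auto
    then have A1: "1 \<le> A" unfolding A_def using K2 mult_mono[of 1 K2 1] by simp
    have "wmass \<mu> \<phi> (B x (l * r)) (1 / u)
      \<le> ennreal (K2 * (2 * V x (l * r) / V x r) powr p) * wmass \<mu> \<phi> (B x r) (1 / u)"
      using h u by (intro K2 ball_mono) auto
    also have "\<dots> \<le> ennreal A * 1"
    proof (intro mult_mono u ennreal_leI)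
      have "2 * V x (l * r) / V x r \<le> 2 * K3 * l powr n"
        using K3(2)[OF h] V by (simp add: field_simps)
      then show "K2 * (2 * V x (l * r) / V x r) powr p \<le> A"
        unfolding A_def using K2 p V by (intro mult_left_mono powr_mono2) auto
    qed auto
    finally have "L x (l * r) \<le> ennreal (u * (K1 * A) powr (1 / i))"
      using h u A1 by (intro K1 ball_sets) auto
    also have "u * (K1 * A) powr (1 / i) = K * l powr (n * p / i) * u"
      using K1 K2 K3 h by (simp add: A_def K_def powr_mult powr_powr mult_ac)
    also have "ennreal (K * l powr (n * p / i) * u) = ennreal (K * l powr (n * p / i)) * ennreal u"
      using u Kpos by (simp add: ennreal_mult)
    finally show "L x (l * r) \<le> ennreal (K * l powr (n * p / i)) * ennreal u" .
  qed
  then show ?thesis using Kpos by blast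
qed

text \<open>If \<open>\<theta>\<close> is the share of a ball in the normalized mass of the large one, then upper type 1 bounds
  the norm of its indicator by a multiple of \<open>\<theta>\<close>, so that the norms add up.\<close>

lemma sum_L_le:
  assumes i: "0 < i" "lower_type \<mu> i \<phi>"
  shows "\<exists>K>0. \<forall>x\<in>space \<mu>. \<forall>R>0. \<forall>s>0. \<forall>N\<ge>1. \<forall>P. finite P \<longrightarrow> P \<subseteq> space \<mu> \<longrightarrow>
    (\<forall>p\<in>P. B p s \<subseteq> B x R) \<longrightarrow> (\<forall>y\<in>space \<mu>. real (card {p \<in> P. y \<in> B p s}) \<le> N) \<longrightarrow>
    (\<Sum>p\<in>P. L p s) \<le> ennreal (K * N) * L x R"
proof -
  obtain K1 where K1: "K1 \<ge> 1" "\<And>E l A. E \<in> sets \<mu> \<Longrightarrow> 0 < l \<Longrightarrow> 1 \<le> A \<Longrightarrow> wmass \<mu> \<phi> E (1 / l) \<le> ennreal A \<Longrightarrow>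
      Lphi_norm \<mu> \<phi> (indicator E) \<le> ennreal (l * (K1 * A) powr (1 / i))"
    using Lphi_norm_le_mass[OF i] by blast
  obtain C0 where C0: "\<And>x t s. x \<in> space \<mu> \<Longrightarrow> 0 \<le> t \<Longrightarrow> 1 \<le> s \<Longrightarrow> \<phi> x (s * t) \<le> C0 * s powr 1 * \<phi> x t"
    using growth unfolding growth_function_def upper_type_def by fastforce
  define C where "C = max 1 C0"
  define K where "K = (K1 * C) powr (1 / i)"
  have Kpos: "K > 0" using K1 by (simp add: K_def C_def)
  have "(\<Sum>p\<in>P. L p s) \<le> ennreal (K * N) * L x R"
    if x: "x \<in> space \<mu>" and R: "R > 0" and s: "s > 0" and N: "N \<ge> 1"
      and P: "finite P" "P \<subseteq> space \<mu>" and sub: "\<forall>p\<in>P. B p s \<subseteq> B x R"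
      and overlap: "\<forall>y\<in>space \<mu>. real (card {p \<in> P. y \<in> B p s}) \<le> N"
    for x R s N P
  proof (rule Lphi_norm_ge)
    show "B x R \<in> sets \<mu>" using x R ball_sets by auto
    show "0 < K * N" using Kpos N by simp
    fix l assume l: "0 < l" "wmass \<mu> \<phi> (B x R) (1 / l) \<le> 1"
    have [measurable]: "(\<lambda>y. \<phi> y (1 / l)) \<in> borel_measurable \<mu>" using l by (intro phi_measurable) auto
    have Lp: "L p s \<le> ennreal (K * l) * wmass \<mu> \<phi> (B p s) (1 / l)" if p: "p \<in> P" for p
    proof -
      have psp: "p \<in> space \<mu>" using p P by auto
      note [measurable] = ball_sets[OF psp s]
      have le1: "wmass \<mu> \<phi> (B p s) (1 / l) \<le> 1"
        using wmass_mono[of "B p s" "B x R" "1 / l"] sub p l by (auto intro: order_trans)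
      have "0 < wmass \<mu> \<phi> (B p s) (1 / l)" using psp s l by (intro wmass_pos) auto
      \<comment> \<open>\<open>\<theta> \<le> 1\<close> makes \<open>1 / \<theta>\<close> an
        admissible factor in upper type 1. At level \<open>\<theta> * l\<close> the mass of the
        small ball is then at most \<open>C\<close>.\<close>
      then obtain \<theta> where \<theta>: "wmass \<mu> \<phi> (B p s) (1 / l) = ennreal \<theta>" "0 < \<theta>" "\<theta> \<le> 1"
        using le1 by (cases "wmass \<mu> \<phi> (B p s) (1 / l)") (auto simp: top_unique)
      have "wmass \<mu> \<phi> (B p s) (1 / (\<theta> * l))
          \<le> (\<integral>\<^sup>+y. ennreal (C / \<theta>) * (ennreal (\<phi> y (1 / l)) * indicator (B p s) y) \<partial>\<mu>)"
        unfolding wmass_def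
      proof (rule nn_integral_mono)
        fix y assume y: "y \<in> space \<mu>"
        have "\<phi> y (1 / (\<theta> * l)) = \<phi> y ((1 / \<theta>) * (1 / l))" by (simp add: mult.commute)
        also have "\<dots> \<le> C0 * (1 / \<theta>) powr 1 * \<phi> y (1 / l)" using y l \<theta> by (intro C0) auto
        also have "\<dots> \<le> C * (1 / \<theta>) powr 1 * \<phi> y (1 / l)"
          using phi_nonneg[OF y, of "1 / l"] l by (intro mult_right_mono) (auto simp: C_def)
        finally have "ennreal (\<phi> y (1 / (\<theta> * l))) \<le> ennreal (C / \<theta>) * ennreal (\<phi> y (1 / l))"
          using \<theta> phi_nonneg[OF y, of "1 / l"] l by (simp add: C_def ennreal_leI flip: ennreal_mult)
        then show "ennreal (\<phi> y (1 / (\<theta> * l))) * indicator (B p s) y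
            \<le> ennreal (C / \<theta>) * (ennreal (\<phi> y (1 / l)) * indicator (B p s) y)"
          unfolding mult.assoc[symmetric] by (intro mult_right_mono) auto
      qed
      also have "\<dots> = ennreal (C / \<theta>) * wmass \<mu> \<phi> (B p s) (1 / l)"
        unfolding wmass_def by (intro nn_integral_cmult) measurable
      also have "\<dots> = ennreal C" using \<theta> by (simp add: C_def flip: ennreal_mult)
      finally have "L p s \<le> ennreal (\<theta> * l * (K1 * C) powr (1 / i))"
        using psp s \<theta> l by (intro K1 ball_sets) (auto simp: C_def)
      also have "\<dots> = ennreal (K * l) * wmass \<mu> \<phi> (B p s) (1 / l)"
        using \<theta> l Kpos by (simp add: K_def mult_ac flip: ennreal_mult)
      finally show ?thesis .
    qed
    have sets[measurable]: "B p s \<in> sets \<mu>" if "p \<in> P" for p using that P s ball_sets by auto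
    have "(\<Sum>p\<in>P. L p s) \<le> (\<Sum>p\<in>P. ennreal (K * l) * wmass \<mu> \<phi> (B p s) (1 / l))"
      by (intro sum_mono Lp)
    also have "\<dots> = ennreal (K * l) * (\<Sum>p\<in>P. wmass \<mu> \<phi> (B p s) (1 / l))"
      by (simp add: sum_distrib_left)
    also have "(\<Sum>p\<in>P. wmass \<mu> \<phi> (B p s) (1 / l))
        = (\<integral>\<^sup>+y. (\<Sum>p\<in>P. ennreal (\<phi> y (1 / l)) * indicator (B p s) y) \<partial>\<mu>)"
      unfolding wmass_def by (rule nn_integral_sum[symmetric]) measurable
    also have "\<dots> \<le> (\<integral>\<^sup>+y. ennreal N * (ennreal (\<phi> y (1 / l)) * indicator (B x R) y) \<partial>\<mu>)"
    proof (rule nn_integral_mono)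
      fix y assume y: "y \<in> space \<mu>"
      have card: "(\<Sum>p\<in>P. indicator (B p s) y :: ennreal) = ennreal (real (card {p \<in> P. y \<in> B p s}))"
        using P by (simp add: indicator_def sum.If_cases ennreal_of_nat_eq_real_of_nat Int_def)
      have "(\<Sum>p\<in>P. indicator (B p s) y) \<le> ennreal N * indicator (B x R) y"
      proof (cases "y \<in> B x R")
        case True
        then show ?thesis unfolding card using overlap y by (simp add: ennreal_leI)
      next
        case False
        then have "{p \<in> P. y \<in> B p s} = {}" using sub by auto
        then show ?thesis unfolding card by (simp only: card.empty) simp
      qed
      then have "ennreal (\<phi> y (1 / l)) * (\<Sum>p\<in>P. indicator (B p s) y)
          \<le> ennreal (\<phi> y (1 / l)) * (ennreal N * indicator (B x R) y)"
        by (rule mult_left_mono) simp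
      then show "(\<Sum>p\<in>P. ennreal (\<phi> y (1 / l)) * indicator (B p s) y)
          \<le> ennreal N * (ennreal (\<phi> y (1 / l)) * indicator (B x R) y)"
        by (simp only: sum_distrib_left mult.left_commute[of "ennreal (\<phi> y (1 / l))"])
    qed
    also have "\<dots> = ennreal N * wmass \<mu> \<phi> (B x R) (1 / l)"
      unfolding wmass_def using ball_sets[OF x R, measurable] by (intro nn_integral_cmult) measurable
    also have "\<dots> \<le> ennreal N * 1" by (intro mult_left_mono l) auto
    finally have "(\<Sum>p\<in>P. L p s) \<le> ennreal (K * l) * (ennreal N * 1)" by (simp add: mult_left_mono)
    also have "\<dots> = ennreal (K * N) * ennreal l"
      using Kpos l N by (simp add: mult_ac flip: ennreal_mult)
    finally show "(\<Sum>p\<in>P. L p s) \<le> ennreal (K * N) * ennreal l" .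
  qed
  then show ?thesis using Kpos by blast
qed

text \<open>The scale \<open>s\<close> in the hypothesis is fixed, which is what allows
  \<open>F\<close> to be the oscillation for a single operator. Its integral over a large ball is
  distributed over covering balls of radius \<open>s\<close>, and the sum of their norms is compared
  with the norm of one dilated ball.\<close>

lemma oscillation_dilate:
  assumes i: "0 < i" "lower_type \<mu> i \<phi>" and p: "1 \<le> p" "Ap \<mu> d p \<phi>" and n: "0 < n" "cond_D \<mu> d n"
  shows "\<exists>K>0. \<forall>s>0. \<forall>F\<in>borel_measurable \<mu>. \<forall>D::ennreal.
    (\<forall>z\<in>space \<mu>. (\<integral>\<^sup>+y\<in>B z s. F y \<partial>\<mu>) \<le> D * L z s) \<longrightarrow>
    (\<forall>x\<in>space \<mu>. \<forall>l\<ge>1. (\<integral>\<^sup>+y\<in>B x (l * s). F y \<partial>\<mu>) \<le> D * (ennreal (K * l powr (n * p / i)) * L x s))"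
proof -
  obtain N0 :: real where N0: "\<forall>x\<in>space \<mu>. \<forall>s>0. \<forall>R>0.
    \<exists>P. finite P \<and> P \<subseteq> B x R \<and> B x R \<subseteq> (\<Union>p\<in>P. B p s) \<and>
      (\<forall>y\<in>space \<mu>. real (card {p \<in> P. y \<in> B p s}) \<le> N0)"
    using covering by (rule exE)
  define N where "N = max 1 N0"
  obtain K1 where K1: "K1 > 0 \<and> (\<forall>x\<in>space \<mu>. \<forall>R>0. \<forall>s>0. \<forall>N\<ge>1. \<forall>P. finite P \<longrightarrow> P \<subseteq> space \<mu> \<longrightarrow>
    (\<forall>p\<in>P. B p s \<subseteq> B x R) \<longrightarrow> (\<forall>y\<in>space \<mu>. real (card {p \<in> P. y \<in> B p s}) \<le> N) \<longrightarrow>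
    (\<Sum>p\<in>P. L p s) \<le> ennreal (K1 * N) * L x R)"
    using sum_L_le[OF i] by (rule exE)
  obtain K2 where K2: "K2 > 0" "\<And>x r l. x \<in> space \<mu> \<Longrightarrow> r > 0 \<Longrightarrow> l \<ge> 1 \<Longrightarrow>
      L x (l * r) \<le> ennreal (K2 * l powr (n * p / i)) * L x r"
    using L_dilate[OF i p n] by blast
  define K where "K = K1 * N * (K2 * (2 * \<kappa>) powr (n * p / i))"
  have Kpos: "K > 0" using K1 K2 \<kappa> by (simp add: K_def N_def)
  have "(\<integral>\<^sup>+y\<in>B x (l * s). F y \<partial>\<mu>) \<le> D * (ennreal (K * l powr (n * p / i)) * L x s)"
    if s: "s > 0" and F[measurable]: "F \<in> borel_measurable \<mu>"
      and osc: "\<forall>z\<in>space \<mu>. (\<integral>\<^sup>+y\<in>B z s. F y \<partial>\<mu>) \<le> D * L z s"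
      and x: "x \<in> space \<mu>" and l: "l \<ge> 1" for s F D x l
  proof -
    have ls: "l * s > 0" using l s by simp
    obtain P where P: "finite P" "P \<subseteq> B x (l * s)" "B x (l * s) \<subseteq> (\<Union>p\<in>P. B p s)"
      "\<forall>y\<in>space \<mu>. real (card {p \<in> P. y \<in> B p s}) \<le> N0"
      using N0 x s ls by meson
    have Psp: "P \<subseteq> space \<mu>" using P(2) by (auto simp: in_ball)
    have [measurable]: "B p s \<in> sets \<mu>" if "p \<in> P" for p using that Psp s ball_sets by auto
    have "(\<integral>\<^sup>+y\<in>B x (l * s). F y \<partial>\<mu>) \<le> (\<integral>\<^sup>+y. (\<Sum>p\<in>P. F y * indicator (B p s) y) \<partial>\<mu>)"
    proof (rule nn_integral_mono)
      fix y
      show "F y * indicator (B x (l * s)) y \<le> (\<Sum>p\<in>P. F y * indicator (B p s) y)"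
      proof (cases "y \<in> B x (l * s)")
        case True
        then obtain q where q: "q \<in> P" "y \<in> B q s" using P by blast
        have "F y * indicator (B x (l * s)) y = F y * indicator (B q s) y" using True q by simp
        also have "\<dots> \<le> (\<Sum>p\<in>P. F y * indicator (B p s) y)"
          using q P by (intro member_le_sum) auto
        finally show ?thesis .
      qed simp
    qed
    also have "\<dots> = (\<Sum>p\<in>P. \<integral>\<^sup>+y\<in>B p s. F y \<partial>\<mu>)" by (rule nn_integral_sum) measurable
    also have "\<dots> \<le> (\<Sum>p\<in>P. D * L p s)" using osc Psp by (intro sum_mono) auto
    also have "\<dots> = D * (\<Sum>p\<in>P. L p s)" by (simp add: sum_distrib_left)
    \<comment> \<open>The covering balls stick out of \<open>B x (l * s)\<close>. Since
      \<open>s \<le> l * s\<close> and their centres lie in that ball, the quasi-triangle inequality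
      places them in the ball of radius \<open>2 * \<kappa> * l * s\<close>.\<close>
    also have "\<dots> \<le> D * (ennreal (K1 * N) * L x (2 * \<kappa> * l * s))"
    proof (intro mult_left_mono K1[THEN conjunct2, THEN bspec, THEN spec, THEN mp, THEN spec, THEN mp,
          THEN spec, THEN mp, THEN spec, THEN mp, THEN mp, THEN mp, THEN mp])
      show "\<forall>p\<in>P. B p s \<subseteq> B x (2 * \<kappa> * l * s)"
      proof
        fix p assume p: "p \<in> P"
        have "1 * s \<le> l * s" using l s by (intro mult_right_mono) auto
        moreover have "d p x < l * s" using P(2) p by (auto simp: in_ball)
        ultimately have "s + d p x \<le> 2 * (l * s)" by simp
        then have "\<kappa> * (s + d p x) \<le> \<kappa> * (2 * (l * s))" using \<kappa> by (intro mult_left_mono) auto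
        then show "B p s \<subseteq> B x (2 * \<kappa> * l * s)"
          using p Psp x by (intro ball_subset) (auto simp: mult_ac)
      qed
      show "\<forall>y\<in>space \<mu>. real (card {p \<in> P. y \<in> B p s}) \<le> N" using P(4) by (auto simp: N_def)
    qed (use x s l \<kappa> P Psp in \<open>auto simp: N_def\<close>)
    also have "\<dots> \<le> D * (ennreal (K1 * N) * (ennreal (K2 * (2 * \<kappa> * l) powr (n * p / i)) * L x s))"
    proof (intro mult_left_mono K2 x s)
      show "1 \<le> 2 * \<kappa> * l" using \<kappa> l mult_mono[of 1 "2 * \<kappa>" 1 l] by simp
    qed auto
    also have "ennreal (K1 * N) * (ennreal (K2 * (2 * \<kappa> * l) powr (n * p / i)) * L x s)
        = ennreal (K * l powr (n * p / i)) * L x s"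
    proof -
      have "K1 * N * (K2 * (2 * \<kappa> * l) powr (n * p / i)) = K * l powr (n * p / i)"
        using \<kappa> l by (simp add: K_def powr_mult)
      then show ?thesis
        using K1 K2 by (simp add: N_def mult.assoc[symmetric] flip: ennreal_mult)
    qed
    finally show ?thesis .
  qed
  then show ?thesis using Kpos by blast
qed

section \<open>Indices\<close>

text \<open>Going from 1 down to \<open>s\<close> by lower type \<open>p\<close> and back by upper
  type 1 gives \<open>1 \<le> A * s powr (p - 1)\<close>, which fails for small \<open>s\<close> if
  \<open>p > 1\<close>. The supremum \<open>i_index\<close> is therefore one of a bounded set; on an
  empty space every type holds and it would not be.\<close>

lemma lower_type_le_1:
  assumes ne: "space \<mu> \<noteq> {}" and p: "lower_type \<mu> p \<phi>"
  shows "p \<le> 1"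
proof (rule ccontr)
  assume "\<not> p \<le> 1"
  obtain x where x: "x \<in> space \<mu>" using ne by auto
  obtain C where C: "\<And>t s. 0 \<le> t \<Longrightarrow> 0 < s \<Longrightarrow> s < 1 \<Longrightarrow> \<phi> x (s * t) \<le> C * s powr p * \<phi> x t"
    using p x unfolding lower_type_def by fastforce
  obtain C' where C': "\<And>t s. 0 \<le> t \<Longrightarrow> 1 \<le> s \<Longrightarrow> \<phi> x (s * t) \<le> C' * s powr 1 * \<phi> x t"
    using growth x unfolding growth_function_def upper_type_def by fastforce
  define A where "A = max 1 C * max 1 C'"
  have A: "A \<ge> 1" unfolding A_def using mult_mono[of 1 "max 1 C" 1 "max 1 C'"] by simp
  have key: "1 \<le> A * s powr (p - 1)" if s: "0 < s" "s < 1" for s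
  proof -
    have "\<phi> x 1 = \<phi> x ((1 / s) * s)" using s by simp
    also have "\<dots> \<le> C' * (1 / s) powr 1 * \<phi> x s" using s by (intro C') auto
    also have "\<dots> \<le> max 1 C' * (1 / s) * \<phi> x s"
      using s phi_pos[OF x s(1)] by (auto intro!: mult_right_mono divide_right_mono)
    also have "\<dots> \<le> max 1 C' * (1 / s) * (max 1 C * s powr p * \<phi> x 1)"
    proof (rule mult_left_mono)
      have "\<phi> x s \<le> C * s powr p * \<phi> x 1" using C[of 1 s] s by simp
      also have "\<dots> \<le> max 1 C * s powr p * \<phi> x 1"
        using phi_pos[OF x, of 1] by (intro mult_right_mono) auto
      finally show "\<phi> x s \<le> max 1 C * s powr p * \<phi> x 1" .
    qed (use s in auto)
    also have "\<dots> = A * s powr (p - 1) * \<phi> x 1" using s by (simp add: A_def powr_diff)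
    finally show ?thesis using phi_pos[OF x, of 1] by simp
  qed
  \<comment> \<open>Chosen so that \<open>A * s powr (p - 1) = 1 / 2\<close>.\<close>
  define s where "s = (1 / (2 * A)) powr (1 / (p - 1))"
  have "0 < s" using A by (simp add: s_def)
  moreover have "s < 1" unfolding s_def using A \<open>\<not> p \<le> 1\<close> powr_less_mono2[of "1 / (p - 1)" "1 / (2 * A)" 1] by simp
  ultimately have "1 \<le> A * s powr (p - 1)" by (rule key)
  moreover have "s powr (p - 1) = 1 / (2 * A)" using A \<open>\<not> p \<le> 1\<close> by (simp add: s_def powr_powr)
  ultimately show False using A by simp
qed

lemma i_index_bounds:
  assumes "space \<mu> \<noteq> {}"
  shows "0 < i_index \<mu> \<phi>" "i_index \<mu> \<phi> \<le> 1"
    and "u < i_index \<mu> \<phi> \<Longrightarrow> \<exists>i. 0 < i \<and> lower_type \<mu> i \<phi> \<and> u < i"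
proof -
  obtain i0 where i0: "0 < i0" "lower_type \<mu> i0 \<phi>"
    using growth unfolding growth_function_def by auto
  have bdd: "bdd_above {i. 0 < i \<and> lower_type \<mu> i \<phi>}"
    using lower_type_le_1[OF assms] by (intro bdd_aboveI[of _ 1]) auto
  have "i0 \<le> i_index \<mu> \<phi>" unfolding i_index_def using i0 bdd by (intro cSup_upper) auto
  then show "0 < i_index \<mu> \<phi>" using i0 by simp
  show "i_index \<mu> \<phi> \<le> 1" unfolding i_index_def using i0 lower_type_le_1[OF assms]
    by (intro cSup_least) auto
  show "\<exists>i. 0 < i \<and> lower_type \<mu> i \<phi> \<and> u < i" if "u < i_index \<mu> \<phi>"
    using that i0 bdd unfolding i_index_def by (subst (asm) less_cSup_iff) auto
qed

lemma p_index_bounds: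
  shows "1 \<le> p_index \<mu> d \<phi>"
    and "p_index \<mu> d \<phi> < u \<Longrightarrow> \<exists>p\<ge>1. Ap \<mu> d p \<phi> \<and> p < u"
proof -
  obtain p0 where p0: "1 \<le> p0" "Ap \<mu> d p0 \<phi>"
    using growth unfolding growth_function_def A_infty_def by auto
  show "1 \<le> p_index \<mu> d \<phi>" unfolding p_index_def using p0 by (intro cInf_greatest) auto
  show "\<exists>p\<ge>1. Ap \<mu> d p \<phi> \<and> p < u" if "p_index \<mu> d \<phi> < u"
    using that p0 unfolding p_index_def by (subst (asm) cInf_less_iff) (auto intro: bdd_belowI[of _ 1])
qed

text \<open>The indices are replaced one at a time, first \<open>i\<close>, then \<open>p\<close>,
  then \<open>n\<close>; the inequality stays strict after each replacement and so leaves room for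
  the next.\<close>

lemma exponents_below:
  assumes ne: "space \<mu> \<noteq> {}" and M: "0 < M" "deg_n \<mu> d * p_index \<mu> d \<phi> / i_index \<mu> \<phi> < M"
  obtains n p i where "0 < n" "cond_D \<mu> d n" "1 \<le> p" "Ap \<mu> d p \<phi>" "0 < i" "lower_type \<mu> i \<phi>" "n * p / i < M"
proof -
  have "deg_n \<mu> d * p_index \<mu> d \<phi> / M < i_index \<mu> \<phi>"
    using M i_index_bounds(1)[OF ne] by (simp add: field_simps)
  then obtain i where i: "0 < i" "lower_type \<mu> i \<phi>" "deg_n \<mu> d * p_index \<mu> d \<phi> / M < i"
    using i_index_bounds(3)[OF ne] by blast
  obtain p where p: "1 \<le> p" "Ap \<mu> d p \<phi>" "deg_n \<mu> d * p < M * i"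
  \<comment> \<open>For \<open>deg_n = 0\<close> the condition on \<open>p\<close> reads
    \<open>0 < M * i\<close>, so any Muckenhoupt exponent will do; otherwise one divides by
    \<open>deg_n\<close>.\<close>
  proof (cases "deg_n \<mu> d = 0")
    case True
    obtain p where "1 \<le> p" "Ap \<mu> d p \<phi>" using p_index_bounds(2)[of "p_index \<mu> d \<phi> + 1"] by auto
    then show ?thesis using that True M i by simp
  next
    case False
    then have n0: "deg_n \<mu> d > 0" using deg_n_nonneg by simp
    then have "p_index \<mu> d \<phi> < M * i / deg_n \<mu> d" using i M by (simp add: field_simps)
    then obtain p where "1 \<le> p" "Ap \<mu> d p \<phi>" "p < M * i / deg_n \<mu> d" using p_index_bounds(2) by blast
    then show ?thesis using that n0 by (simp add: field_simps)
  qed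
  have "deg_n \<mu> d < M * i / p" using p by (simp add: field_simps)
  then obtain n where n: "0 < n" "cond_D \<mu> d n" "n < M * i / p" using deg_n_less by blast
  then have "n * p / i < M" using p i by (simp add: field_simps)
  with n p i show ?thesis using that by blast
qed

end

text \<open>If there is no reverse Hoelder exponent, then \<open>r_index\<close> is minus infinity;
  \<open>real_of_ereal\<close> sends it to 0, and division by 0 makes the ratio 0. Otherwise
  \<open>r_index\<close> exceeds 1 and the bound is clear.\<close>

lemma r_ratio_le_1: "r_ratio (r_index \<mu> d \<phi>) \<le> 1"
proof (cases "r_index \<mu> d \<phi>")
  case (real r)
  show ?thesis
  proof (cases "{q. 1 < q \<and> RH \<mu> d q \<phi>} = {}")
    case True
    then have "r_index \<mu> d \<phi> = -\<infinity>" unfolding r_index_def True by (simp add: bot_ereal_def)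
    then show ?thesis using real by simp
  next
    case False
    then obtain q where q: "1 < q" "RH \<mu> d q \<phi>" by auto
    then have "q \<le> r_index \<mu> d \<phi>" unfolding r_index_def by (intro Sup_upper) auto
    with q(1) have "1 < r_index \<mu> d \<phi>" by (rule less_le_trans)
    then have "1 < r" using real by (simp add: one_ereal_def)
    then show ?thesis using real by (simp add: r_ratio_def)
  qed
qed (simp_all add: r_ratio_def)

section \<open>Comparison of the norms\<close>

text \<open>Boundedness handles small \<open>r\<close> and the limit handles large \<open>r\<close>.
  The constant \<open>2 powr M\<close> comes from \<open>1 + r \<le> 2 * r\<close> for
  \<open>r \<ge> 1\<close>, the other summand of \<open>G\<close> from the bound for
  \<open>g\<close> on the remaining interval.\<close>

lemma kernel_profile_decay:
  fixes g :: "real \<Rightarrow> real"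
  assumes M: "0 < M" and bdd: "bounded (g ` {0..})"
    and lim: "((\<lambda>r. r powr M * g (r powr m)) \<longlongrightarrow> 0) at_top"
  shows "\<exists>G>0. \<forall>r\<ge>0. g (r powr m) \<le> G * (1 + r) powr - M"
proof -
  obtain b where b: "\<And>u. 0 \<le> u \<Longrightarrow> \<bar>g u\<bar> \<le> b" using bdd by (auto simp: bounded_iff)
  have "eventually (\<lambda>r. r powr M * g (r powr m) < 1) at_top"
    using lim by (rule order_tendstoD) simp
  then obtain R0 where R0: "\<And>r. R0 \<le> r \<Longrightarrow> r powr M * g (r powr m) < 1"
    by (auto simp: eventually_at_top_linorder)
  define R where "R = max 1 R0"
  have "0 \<le> b" using b[of 0] by auto
  define G where "G = 2 powr M + b * (1 + R) powr M"
  have b0: "0 \<le> b * (1 + R) powr M" using \<open>0 \<le> b\<close> by simp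
  then have G: "2 powr M \<le> G" "b * (1 + R) powr M \<le> G" by (auto simp: G_def)
  have "g (r powr m) \<le> G * (1 + r) powr - M" if r: "0 \<le> r" for r
  proof (cases "R \<le> r")
    case True
    then have r1: "1 \<le> r" "R0 \<le> r" by (auto simp: R_def)
    have "g (r powr m) \<le> r powr - M" using R0[OF r1(2)] r1 by (simp add: powr_minus field_simps)
    also have "\<dots> \<le> ((1 + r) / 2) powr - M" using r1 M by (intro powr_mono2') auto
    also have "\<dots> = 2 powr M * (1 + r) powr - M" using r1 by (simp add: powr_divide powr_minus_divide)
    also have "\<dots> \<le> G * (1 + r) powr - M" using G by (intro mult_right_mono) auto
    finally show ?thesis .
  next
    case False
    have "g (r powr m) \<le> b" using b[of "r powr m"] by auto
    also have "\<dots> = b * (1 + R) powr M * (1 + R) powr - M"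
      using False r by (simp add: powr_minus field_simps)
    also have "\<dots> \<le> b * (1 + R) powr M * (1 + r) powr - M"
      using False r M b0 by (intro mult_left_mono powr_mono2') auto
    also have "\<dots> \<le> G * (1 + r) powr - M" using G by (intro mult_right_mono) auto
    finally show ?thesis .
  qed
  moreover have "0 < G" using G by (rule_tac less_le_trans[of _ "2 powr M"]) auto
  ultimately show ?thesis by blast
qed

text \<open>The substitution \<open>t = s powr m\<close> makes the scale of the kernel a radius, as
  in the general estimates for decaying kernels.\<close>

lemma (in growth_space) approximation_kernel_bound:
  assumes A: "gen_approx_identity \<mu> d \<phi> M m g a" and M: "0 < M"
  shows "\<exists>G>0. \<forall>s>0. \<forall>x\<in>space \<mu>. \<forall>y\<in>space \<mu>.
    cmod (a (s powr m) x y) \<le> G * ((1 + d y x / s) powr - M / V x s)"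
proof -
  have A: "m > 0" "bounded (g ` {0..})" "((\<lambda>r. r powr M * g (r powr m)) \<longlongrightarrow> 0) at_top"
    "\<And>t x y. t > 0 \<Longrightarrow> x \<in> space \<mu> \<Longrightarrow> y \<in> space \<mu> \<Longrightarrow>
        cmod (a t x y) \<le> g ((d x y) powr m / t) / V x (t powr (1 / m))"
    using A unfolding gen_approx_identity_def by blast+
  obtain G where G: "G > 0" "\<And>r. 0 \<le> r \<Longrightarrow> g (r powr m) \<le> G * (1 + r) powr - M"
    using kernel_profile_decay[OF M A(2,3)] by blast
  have "cmod (a (s powr m) x y) \<le> G * ((1 + d y x / s) powr - M / V x s)"
    if h: "s > 0" "x \<in> space \<mu>" "y \<in> space \<mu>" for s x y
  proof -
    have sm: "(s powr m) powr (1 / m) = s" using A(1) h by (simp add: powr_powr)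
    have "cmod (a (s powr m) x y) \<le> g ((d x y) powr m / s powr m) / V x s"
      using A(4)[of "s powr m" x y] h unfolding sm by simp
    also have "(d x y) powr m / s powr m = (d y x / s) powr m"
      using h d_nonneg d_sym[of x y] by (simp add: powr_divide)
    also have "g ((d y x / s) powr m) / V x s \<le> G * (1 + d y x / s) powr - M / V x s"
      using h d_nonneg by (intro divide_right_mono G) auto
    finally show ?thesis by simp
  qed
  then show ?thesis using G(1) by blast
qed

lemma (in growth_space) op_A_measurable:
  assumes A: "gen_approx_identity \<mu> d \<phi> M m g a" and f: "f \<in> borel_measurable \<mu>" and t: "0 < t"
  shows "op_A \<mu> a t f \<in> borel_measurable \<mu>"
proof -
  have "(\<lambda>(x, y). a t x y) \<in> borel_measurable (\<mu> \<Otimes>\<^sub>M \<mu>)"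
    using A t unfolding gen_approx_identity_def by blast
  from integral_kernel_measurable[OF this f] show ?thesis using t by (simp add: op_A_def[abs_def])
qed

text \<open>Write \<open>q\<close> for \<open>p_index / i_index\<close>, which is at least 1. Since
  \<open>r_ratio \<le> 1\<close> and \<open>deg_alpha \<le> deg_n\<close>, Assumption A yields
  \<open>M > 2 * deg_n * q - deg_n + deg_N\<close>. This is at least
  \<open>deg_n * q + deg_N\<close>, which dominates both lower bounds.\<close>

lemma (in growth_space) assumption_A_exponents:
  assumes A: "assumption_A \<mu> d \<phi> M m g a" and ne: "space \<mu> \<noteq> {}"
  shows "deg_n \<mu> d + deg_N \<mu> d < M" "deg_n \<mu> d * p_index \<mu> d \<phi> / i_index \<mu> \<phi> < M"
proof -
  let ?q = "p_index \<mu> d \<phi> / i_index \<mu> \<phi>"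
  have q: "1 \<le> ?q" using p_index_bounds(1) i_index_bounds(1,2)[OF ne] by (simp add: field_simps)
  have n: "0 \<le> deg_n \<mu> d" by (rule deg_n_nonneg)
  have "deg_n \<mu> d * r_ratio (r_index \<mu> d \<phi>) \<le> deg_n \<mu> d * 1"
    using n by (intro mult_left_mono r_ratio_le_1)
  moreover have "deg_n \<mu> d * 1 \<le> deg_n \<mu> d * ?q" using n q by (intro mult_left_mono)
  moreover have "M > deg_n \<mu> d + 2 * (deg_n \<mu> d * ?q) + deg_N \<mu> d
         - deg_n \<mu> d * r_ratio (r_index \<mu> d \<phi>) - deg_alpha \<mu> d"
    using A by (simp add: assumption_A_def)
  ultimately show "deg_n \<mu> d + deg_N \<mu> d < M" "deg_n \<mu> d * p_index \<mu> d \<phi> / i_index \<mu> \<phi> < M"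
    using deg_alpha_le deg_N_nonneg n by auto
qed

section \<open>The two inequalities between the norms\<close>

context growth_space
begin

text \<open>Nonnegativity of the kernel rules out cancellation, so the integral over the whole space
  dominates the part over the ball. The estimate covers all of \<open>MX\<close>, including
  functions of infinite norm.\<close>

lemma BMO_norm_le_BMO_max_norm:
  assumes A: "assumption_A \<mu> d \<phi> M m g a"
    and nonneg: "\<And>t x y. t > 0 \<Longrightarrow> x \<in> space \<mu> \<Longrightarrow> y \<in> space \<mu> \<Longrightarrow> a t x y \<in> \<real>\<^sub>\<ge>\<^sub>0"
    and C: "C > 0"
    and lower: "\<And>t x y. t > 0 \<Longrightarrow> x \<in> space \<mu> \<Longrightarrow> y \<in> B x (t powr (1 / m)) \<Longrightarrow>
           Re (a t x y) \<ge> C / V x (t powr (1 / m))"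
    and f: "f \<in> MX \<mu> d \<phi> M"
  shows "BMO_norm \<mu> d \<phi> m a f \<le> ennreal (1 / C) * BMO_max_norm \<mu> d \<phi> m a f"
proof -
  have "(\<integral>\<^sup>+y\<in>B x r. ennreal (cmod (f y - op_A \<mu> a (r powr m) f y)) \<partial>\<mu>) / L x r
      \<le> ennreal (1 / C) * BMO_max_norm \<mu> d \<phi> m a f" if x: "x \<in> space \<mu>" and r: "0 < r" for x r
  proof -
    have ne: "space \<mu> \<noteq> {}" using x by auto
    have gA: "gen_approx_identity \<mu> d \<phi> M m g a" using A by (simp add: assumption_A_def)
    have M: "deg_n \<mu> d + deg_N \<mu> d < M" by (rule assumption_A_exponents[OF A ne])
    then have M0: "0 < M" using deg_n_nonneg deg_N_nonneg by simp
    \<comment> \<open>\<open>N\<close> and then \<open>n\<close> are taken just above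
      \<open>deg_N\<close> and \<open>deg_n\<close>, with \<open>n + N < M\<close> preserved, as
      composing two kernels requires.\<close>
    obtain N where N: "0 \<le> N" "cond_E \<mu> d N" "N < M - deg_n \<mu> d"
      using deg_N_less[of "M - deg_n \<mu> d"] M by auto
    obtain n where n: "0 < n" "cond_D \<mu> d n" "n < M - N" using deg_n_less[of "M - N"] N by auto
    obtain G where G: "G > 0" "\<And>s x y. s > 0 \<Longrightarrow> x \<in> space \<mu> \<Longrightarrow> y \<in> space \<mu> \<Longrightarrow>
      cmod (a (s powr m) x y) \<le> G * ((1 + d y x / s) powr - M / V x s)"
      using approximation_kernel_bound[OF gA M0] by blast
    have m: "m > 0" using gA by (simp add: gen_approx_identity_def)
    define t where "t = r powr m"
    have t: "t > 0" "t powr (1 / m) = r" using r m by (auto simp: t_def powr_powr)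
    have fm[measurable]: "f \<in> borel_measurable \<mu>" using f by (auto simp: MX_def MX_at_def L1_loc_def)
    have am: "(\<lambda>(x, y). a t x y) \<in> borel_measurable (\<mu> \<Otimes>\<^sub>M \<mu>)"
      using gA t unfolding gen_approx_identity_def by blast
    define F where "F y = cmod (f y - op_A \<mu> a t f y)" for y
    have [measurable]: "op_A \<mu> a t f \<in> borel_measurable \<mu>" by (rule op_A_measurable[OF gA fm t(1)])
    have [measurable]: "F \<in> borel_measurable \<mu>" unfolding F_def by measurable
    note [measurable] = ball_sets[OF x r]
    \<comment> \<open>Without integrability \<open>op_A\<close> would take the value 0 here and
      could not dominate the integral over the ball.\<close>
    have int: "integrable \<mu> (\<lambda>y. a t x y * complex_of_real (F y))"
      unfolding F_def op_A_def using t(1)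
      using integrable_kernel_oscillation[OF n(2) less_imp_le[OF n(1)] N(2,1) _ am fm r less_imp_le[OF G(1)] _ x
          MX_integrable_decay[OF f less_imp_le[OF M0] x r]] n G(2) r
      by (simp add: t_def)
    have Vx: "V x r > 0" using V_pos x r by auto
    define I where "I = op_A \<mu> a t (\<lambda>y. complex_of_real (F y)) x"
    have I: "I = (LINT y|\<mu>. a t x y * complex_of_real (F y))" using t by (simp add: I_def op_A_def)
    have Re_nonneg: "0 \<le> Re (a t x y)" if "y \<in> space \<mu>" for y
      using nonneg[OF t(1) x that] by (auto simp: complex_nonneg_Reals_iff)
    have "ennreal (C / V x r) * (\<integral>\<^sup>+y\<in>B x r. ennreal (F y) \<partial>\<mu>)
        = (\<integral>\<^sup>+y. ennreal (C / V x r) * (ennreal (F y) * indicator (B x r) y) \<partial>\<mu>)"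
      by (rule nn_integral_cmult[symmetric]) measurable
    also have "\<dots> \<le> (\<integral>\<^sup>+y. ennreal (Re (a t x y * complex_of_real (F y))) \<partial>\<mu>)"
    proof (rule nn_integral_mono)
      fix y assume y: "y \<in> space \<mu>"
      show "ennreal (C / V x r) * (ennreal (F y) * indicator (B x r) y)
          \<le> ennreal (Re (a t x y * complex_of_real (F y)))"
      proof (cases "y \<in> B x r")
        case True
        then have "C / V x r * F y \<le> Re (a t x y) * F y"
          using lower[OF t(1) x, of y] t by (intro mult_right_mono) (auto simp: F_def)
        then show ?thesis using True C Vx by (simp add: F_def ennreal_leI flip: ennreal_mult)
      qed simp
    qed
    also have "\<dots> = ennreal (Re I)"
    proof -
      have "integrable \<mu> (\<lambda>y. Re (a t x y * complex_of_real (F y)))" using int by (rule integrable_Re)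
      moreover have "AE y in \<mu>. 0 \<le> Re (a t x y * complex_of_real (F y))"
        using Re_nonneg by (intro AE_I2) (simp add: F_def)
      moreover have "(LINT y|\<mu>. Re (a t x y * complex_of_real (F y))) = Re I"
        unfolding I using int by (rule integral_Re)
      ultimately show ?thesis by (simp only: nn_integral_eq_integral)
    qed
    also have "\<dots> \<le> ennreal (cmod I)" by (intro ennreal_leI complex_Re_le_cmod)
    finally have key: "ennreal (C / V x r) * (\<integral>\<^sup>+y\<in>B x r. ennreal (F y) \<partial>\<mu>) \<le> ennreal (cmod I)" .
    have "(\<integral>\<^sup>+y\<in>B x r. ennreal (F y) \<partial>\<mu>)
        = ennreal (V x r / C) * (ennreal (C / V x r) * (\<integral>\<^sup>+y\<in>B x r. ennreal (F y) \<partial>\<mu>))"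
      using C Vx by (simp add: mult.assoc[symmetric] flip: ennreal_mult)
    also have "\<dots> \<le> ennreal (V x r / C) * ennreal (cmod I)" by (intro mult_left_mono key) auto
    also have "\<dots> = ennreal (1 / C) * (ennreal (V x r) * ennreal (cmod I))"
      using C Vx by (simp flip: ennreal_mult)
    finally have "(\<integral>\<^sup>+y\<in>B x r. ennreal (F y) \<partial>\<mu>) / L x r
        \<le> ennreal (1 / C) * (ennreal (V x r) * ennreal (cmod I)) / L x r"
      by (rule divide_right_mono_ennreal)
    also have "\<dots> = ennreal (1 / C) * (emeasure \<mu> (B x r) / L x r * ennreal (cmod I))"
      using x r by (simp add: emeasure_ball divide_ennreal_def mult_ac)
    also have "\<dots> \<le> ennreal (1 / C) * BMO_max_norm \<mu> d \<phi> m a f"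
    proof (rule mult_left_mono)
      show "emeasure \<mu> (B x r) / L x r * ennreal (cmod I) \<le> BMO_max_norm \<mu> d \<phi> m a f"
        unfolding BMO_max_norm_def using x t by (intro SUP_upper2[of "(t, x)"]) (auto simp: I_def F_def)
    qed simp
    finally show ?thesis by (simp add: F_def t_def)
  qed
  then show ?thesis unfolding BMO_norm_def by (intro SUP_least) auto
qed

text \<open>Functions of finite \<open>BMO_norm\<close> are singled out because that finiteness is
  used to recover the oscillation on a ball whose indicator has norm 0. The constant
  \<open>K\<close> is independent of \<open>f\<close>.\<close>

lemma BMO_max_norm_le_BMO_norm:
  assumes A: "assumption_A \<mu> d \<phi> M m g a" and ne: "space \<mu> \<noteq> {}"
  shows "\<exists>K>0. \<forall>f\<in>BMO \<mu> d \<phi> M m a. BMO_max_norm \<mu> d \<phi> m a f \<le> ennreal K * BMO_norm \<mu> d \<phi> m a f"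
proof -
  have gA: "gen_approx_identity \<mu> d \<phi> M m g a" using A by (simp add: assumption_A_def)
  have m: "m > 0" using gA by (simp add: gen_approx_identity_def)
  have M0: "0 < M" using assumption_A_exponents(1)[OF A ne] deg_n_nonneg deg_N_nonneg by simp
  obtain n p i where h: "0 < n" "cond_D \<mu> d n" "1 \<le> p" "Ap \<mu> d p \<phi>" "0 < i" "lower_type \<mu> i \<phi>"
    and npi: "n * p / i < M"
    using exponents_below[OF ne M0 assumption_A_exponents(2)[OF A ne]] by blast
  define \<sigma> where "\<sigma> = n * p / i"
  have \<sigma>: "0 \<le> \<sigma>" "\<sigma> < M" using h npi by (auto simp: \<sigma>_def)
  obtain G where G: "G > 0" "\<And>s x y. s > 0 \<Longrightarrow> x \<in> space \<mu> \<Longrightarrow> y \<in> space \<mu> \<Longrightarrow>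
    cmod (a (s powr m) x y) \<le> G * ((1 + d y x / s) powr - M / V x s)"
    using approximation_kernel_bound[OF gA M0] by blast
  obtain K1 where K1: "K1 > 0" "\<And>s F D x l. s > 0 \<Longrightarrow> F \<in> borel_measurable \<mu> \<Longrightarrow>
      \<forall>z\<in>space \<mu>. (\<integral>\<^sup>+y\<in>B z s. F y \<partial>\<mu>) \<le> D * L z s \<Longrightarrow> x \<in> space \<mu> \<Longrightarrow> l \<ge> 1 \<Longrightarrow>
      (\<integral>\<^sup>+y\<in>B x (l * s). F y \<partial>\<mu>) \<le> D * (ennreal (K1 * l powr \<sigma>) * L x s)"
    using oscillation_dilate[OF h(5,6,3,4,1,2)] unfolding \<sigma>_def by blast
  define c0 where "c0 = 2 powr M / (1 - 2 powr (\<sigma> - M))"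
  have c0: "c0 > 0" using \<sigma> by (simp add: c0_def powr_less_one)
  define K where "K = G * c0 * K1"
  have Kpos: "K > 0" using G K1 c0 by (simp add: K_def)
  have "BMO_max_norm \<mu> d \<phi> m a f \<le> ennreal K * BMO_norm \<mu> d \<phi> m a f"
    if f: "f \<in> BMO \<mu> d \<phi> M m a" for f
  proof -
    have "emeasure \<mu> (B x (t powr (1 / m))) / L x (t powr (1 / m)) *
        ennreal (cmod (op_A \<mu> a t (\<lambda>y. complex_of_real (cmod (f y - op_A \<mu> a t f y))) x))
        \<le> ennreal K * BMO_norm \<mu> d \<phi> m a f" if t: "0 < t" and x: "x \<in> space \<mu>" for t x
    proof -
      define D where "D = BMO_norm \<mu> d \<phi> m a f"
      have D: "D < \<infinity>" using f by (simp add: BMO_def D_def)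
      have fm[measurable]: "f \<in> borel_measurable \<mu>"
        using f by (auto simp: BMO_def MX_def MX_at_def L1_loc_def)
      define s where "s = t powr (1 / m)"
      have s: "0 < s" "s powr m = t" using t m by (auto simp: s_def powr_powr)
      define F where "F y = cmod (f y - op_A \<mu> a t f y)" for y
      have [measurable]: "op_A \<mu> a t f \<in> borel_measurable \<mu>" by (rule op_A_measurable[OF gA fm t])
      have Fm[measurable]: "F \<in> borel_measurable \<mu>" unfolding F_def by measurable
      have Vx: "V x s > 0" using V_pos x s by auto
      have osc: "(\<integral>\<^sup>+y\<in>B z s. ennreal (F y) \<partial>\<mu>) \<le> D * L z s" if z: "z \<in> space \<mu>" for z
      proof -
        let ?S = "\<integral>\<^sup>+y\<in>B z s. ennreal (F y) \<partial>\<mu>"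
        have le: "?S / L z s \<le> D"
          unfolding D_def BMO_norm_def using z s by (intro SUP_upper2[of "(z, s)"]) (auto simp: F_def)
        show ?thesis
        \<comment> \<open>A nonzero extended real divided by 0 is infinite, so a finite
          \<open>D\<close> forces the oscillation to vanish in this case.\<close>
        proof (cases "L z s = 0")
          case True
          then have "?S = 0"
            using le D by (cases "?S = 0") (auto simp: ennreal_divide_zero top_unique)
          then show ?thesis by simp
        next
          case False
          have "L z s < \<infinity>" using L_finite[OF h(5,6,3,4) z s(1)] .
          then have "?S = ?S / L z s * L z s" using False
            by (simp add: ennreal_divide_times)
          also have "\<dots> \<le> D * L z s" using le by (intro mult_right_mono) auto
          finally show ?thesis .
        qed
      qed
      have dec: "(\<integral>\<^sup>+y. ennreal ((1 + d y x / s) powr - M) * ennreal (F y) \<partial>\<mu>)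
          \<le> ennreal c0 * (D * (ennreal K1 * L x s))"
        unfolding c0_def
      proof (rule nn_integral_decay[OF x s(1) \<sigma>])
        fix k :: nat
        have "(\<integral>\<^sup>+y\<in>B x (2 ^ k * s). ennreal (F y) \<partial>\<mu>) \<le> D * (ennreal (K1 * (2 ^ k) powr \<sigma>) * L x s)"
          using s x osc by (intro K1) auto
        also have "\<dots> = D * (ennreal K1 * L x s) * ennreal ((2 ^ k) powr \<sigma>)"
          using K1(1) by (simp add: ennreal_mult mult_ac)
        finally show "(\<integral>\<^sup>+y\<in>B x (2 ^ k * s). ennreal (F y) \<partial>\<mu>)
            \<le> D * (ennreal K1 * L x s) * ennreal ((2 ^ k) powr \<sigma>)" .
      qed measurable
      let ?I = "op_A \<mu> a t (\<lambda>y. complex_of_real (F y)) x"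
      \<comment> \<open>In the divergent case \<open>op_A\<close> is 0, so no convergence has to be
        shown in this direction.\<close>
      have "ennreal (cmod ?I) \<le> (\<integral>\<^sup>+y. ennreal (cmod (a t x y * complex_of_real (F y))) \<partial>\<mu>)"
        using t by (cases "integrable \<mu> (\<lambda>y. a t x y * complex_of_real (F y))")
          (auto simp: op_A_def not_integrable_integral_eq intro: integral_norm_bound_ennreal)
      also have "\<dots> \<le> (\<integral>\<^sup>+y. ennreal (G / V x s) * (ennreal ((1 + d y x / s) powr - M) * ennreal (F y)) \<partial>\<mu>)"
      proof (rule nn_integral_mono)
        fix y assume y: "y \<in> space \<mu>"
        have F0: "0 \<le> F y" by (simp add: F_def)
        have "cmod (a t x y) * F y \<le> G * ((1 + d y x / s) powr - M / V x s) * F y"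
          using G(2)[OF s(1) x y] F0 unfolding s(2) by (rule mult_right_mono)
        then have "cmod (a t x y * complex_of_real (F y)) \<le> G * ((1 + d y x / s) powr - M / V x s) * F y"
          using F0 by (simp add: norm_mult)
        then show "ennreal (cmod (a t x y * complex_of_real (F y)))
            \<le> ennreal (G / V x s) * (ennreal ((1 + d y x / s) powr - M) * ennreal (F y))"
          using G Vx by (simp add: F_def ennreal_leI flip: ennreal_mult)
      qed
      also have "\<dots> = ennreal (G / V x s) * (\<integral>\<^sup>+y. ennreal ((1 + d y x / s) powr - M) * ennreal (F y) \<partial>\<mu>)"
        using d_measurable[OF x, measurable] by (intro nn_integral_cmult) measurable
      also have "\<dots> \<le> ennreal (G / V x s) * (ennreal c0 * (D * (ennreal K1 * L x s)))"
        by (intro mult_left_mono dec) auto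
      finally have "emeasure \<mu> (B x s) / L x s * ennreal (cmod ?I)
          \<le> emeasure \<mu> (B x s) / L x s * (ennreal (G / V x s) * (ennreal c0 * (D * (ennreal K1 * L x s))))"
        by (intro mult_left_mono) auto
      also have "\<dots> = (ennreal (V x s) * ennreal (G / V x s)) * ennreal c0 * ennreal K1 * D * (L x s / L x s)"
        using x s by (simp add: emeasure_ball divide_ennreal_def mult_ac)
      also have "\<dots> \<le> (ennreal (V x s) * ennreal (G / V x s)) * ennreal c0 * ennreal K1 * D * 1"
      proof (intro mult_left_mono)
        \<comment> \<open>The quotient is 1 for a norm that is neither 0 nor infinite, and 0 in the
          two degenerate cases.\<close>
        show "L x s / L x s \<le> 1"
          by (cases "L x s = 0 \<or> L x s = \<infinity>") (auto simp: ennreal_divide_self less_top)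
      qed auto
      also have "\<dots> = ennreal K * D"
        using Vx G c0 K1 by (simp add: K_def mult_ac flip: ennreal_mult)
      finally show ?thesis by (simp add: s_def F_def D_def)
    qed
    then show ?thesis unfolding BMO_max_norm_def by (intro SUP_least) auto
  qed
  then show ?thesis using Kpos by blast
qed

end

theorem theorem3p12:
  fixes \<mu> :: "'a measure" and d :: "'a \<Rightarrow> 'a \<Rightarrow> real" and \<phi> :: "'a \<Rightarrow> real \<Rightarrow> real"
    and M m C :: real and g :: "real \<Rightarrow> real" and a :: "real \<Rightarrow> 'a \<Rightarrow> 'a \<Rightarrow> complex"
  assumes "homogeneous_type \<mu> d"
    and "growth_function \<mu> d \<phi>"
    and "assumption_A \<mu> d \<phi> M m g a"
    and "\<And>t x y. t > 0 \<Longrightarrow> x \<in> space \<mu> \<Longrightarrow> y \<in> space \<mu> \<Longrightarrow> a t x y \<in> \<real>\<^sub>\<ge>\<^sub>0"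
    and "C > 0"
    and "\<And>t x y. t > 0 \<Longrightarrow> x \<in> space \<mu> \<Longrightarrow> y \<in> qball \<mu> d x (t powr (1 / m)) \<Longrightarrow>
           Re (a t x y) \<ge> C / measure \<mu> (qball \<mu> d x (t powr (1 / m)))"
  shows "BMO_max \<mu> d \<phi> M m a = BMO \<mu> d \<phi> M m a \<and>
    (\<exists>c K::real. 0 < c \<and> 0 < K \<and> (\<forall>f\<in>BMO \<mu> d \<phi> M m a.
       ennreal c * BMO_max_norm \<mu> d \<phi> m a f \<le> BMO_norm \<mu> d \<phi> m a f \<and>
       BMO_norm \<mu> d \<phi> m a f \<le> ennreal K * BMO_max_norm \<mu> d \<phi> m a f))"
proof (cases "space \<mu> = {}")
  case True
  \<comment> \<open>\<open>MX\<close> is a union over base points, so on an empty space it contains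
    no function at all.\<close>
  then have "BMO_max \<mu> d \<phi> M m a = {}" "BMO \<mu> d \<phi> M m a = {}"
    by (auto simp: BMO_max_def BMO_def MX_def)
  then show ?thesis by (auto intro: exI[of _ 1])
next
  case False
  note H = assms(1)[unfolded homogeneous_type_def quasi_metric_def]
  note metric = H[THEN conjunct1, THEN conjunct1]
    and ball = H[THEN conjunct2, THEN conjunct2, THEN conjunct1]
  obtain \<kappa> where \<kappa>: "1 \<le> \<kappa>"
    "\<forall>x\<in>space \<mu>. \<forall>y\<in>space \<mu>. \<forall>z\<in>space \<mu>. d x y \<le> \<kappa> * (d x z + d z y)"
    using H[THEN conjunct1, THEN conjunct2] by (elim exE conjE) (rule that)
  obtain c where c: "1 \<le> c" "\<forall>x\<in>space \<mu>. \<forall>r>0.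
      emeasure \<mu> (qball \<mu> d x (2 * r)) \<le> ennreal c * emeasure \<mu> (qball \<mu> d x r)"
    using H[THEN conjunct2, THEN conjunct2, THEN conjunct2] by (elim exE conjE) (rule that)
  interpret growth_space \<mu> d \<kappa> c \<phi>
    by unfold_locales (use metric ball \<kappa> c assms(2) in simp_all)
  obtain K where K: "K > 0"
    "\<And>f. f \<in> BMO \<mu> d \<phi> M m a \<Longrightarrow> BMO_max_norm \<mu> d \<phi> m a f \<le> ennreal K * BMO_norm \<mu> d \<phi> m a f"
    using BMO_max_norm_le_BMO_norm[OF assms(3) False] by blast
  \<comment> \<open>As it holds on all of \<open>MX\<close>, this bound also yields the inclusion of
    \<open>BMO_max\<close> in \<open>BMO\<close>.\<close>
  have le: "BMO_norm \<mu> d \<phi> m a f \<le> ennreal (1 / C) * BMO_max_norm \<mu> d \<phi> m a f"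
    if "f \<in> MX \<mu> d \<phi> M" for f
    by (rule BMO_norm_le_BMO_max_norm[OF assms(3-6) that])
  have "BMO_max \<mu> d \<phi> M m a = BMO \<mu> d \<phi> M m a"
  proof (intro equalityI subsetI)
    fix f assume "f \<in> BMO_max \<mu> d \<phi> M m a"
    then have f: "f \<in> MX \<mu> d \<phi> M" "BMO_max_norm \<mu> d \<phi> m a f < \<infinity>" by (auto simp: BMO_max_def)
    have "ennreal (1 / C) * BMO_max_norm \<mu> d \<phi> m a f < \<infinity>"
      using f(2) by (simp add: ennreal_mult_less_top)
    with le[OF f(1)] f show "f \<in> BMO \<mu> d \<phi> M m a" by (auto simp: BMO_def)
  next
    fix f assume f: "f \<in> BMO \<mu> d \<phi> M m a"
    then have "ennreal K * BMO_norm \<mu> d \<phi> m a f < \<infinity>"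
      by (simp add: BMO_def ennreal_mult_less_top)
    with K(2)[OF f] f show "f \<in> BMO_max \<mu> d \<phi> M m a" by (auto simp: BMO_def BMO_max_def)
  qed
  moreover have "ennreal (1 / K) * BMO_max_norm \<mu> d \<phi> m a f \<le> BMO_norm \<mu> d \<phi> m a f"
    if f: "f \<in> BMO \<mu> d \<phi> M m a" for f
  proof -
    have "ennreal (1 / K) * BMO_max_norm \<mu> d \<phi> m a f
        \<le> ennreal (1 / K) * (ennreal K * BMO_norm \<mu> d \<phi> m a f)"
      by (intro mult_left_mono K f) auto
    also have "\<dots> = BMO_norm \<mu> d \<phi> m a f" using K(1) by (simp add: mult.assoc[symmetric] flip: ennreal_mult)
    finally show ?thesis .
  qed
  moreover have "0 < 1 / K" "0 < 1 / C" using K assms(5) by auto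
  ultimately show ?thesis
    using le by (intro conjI exI[of _ "1 / K"] exI[of _ "1 / C"] ballI) (auto simp: BMO_def)
qed

end
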